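(* For each $n$ let $\mathbf{x}^n=\{x_1,\dots,x_n\}$ be an arbitrary configuration of $n$ points in a square of area $n$. The following asymptotics hold for large $n$. (a) Let $(w_n)$ be a sequence with $w_n\to\infty$. There exist networks $G(\mathbf{x}^n)$ connecting up the points of $\mathbf{x}^n$ (one for each $n$) such that, as $n\to\infty$, (i) $\operatorname{len}(G(\mathbf{x}^n))-\operatorname{len}(\operatorname{ST}(\mathbf{x}^n))=o(n)$; (ii) $\operatorname{excess}(G(\mathbf{x}^n))=o(w_n\log n)$. (b) Let $\varepsilon>0$ be fixed. There exist networks $G(\mathbf{x}^n)$ connecting up the points of $\mathbf{x}^n$ (one for each $n$) such that (i) $\operatorname{len}(G(\mathbf{x}^n))-\operatorname{len}(\operatorname{ST}(\mathbf{x}^n))\le \varepsilon n$ for all sufficiently large $n$; (ii) $\operatorname{excess}(G(\mathbf{x}^n))=O(\log n)$ as $n\to\infty$.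
   Context: A network $G(\mathbf{x}^n)$ on a configuration of points $\mathbf{x}^n=\{x_1,\dots,x_n\}$ in the plane is the configuration together with a finite collection of straight line segments in the plane which combine to connect every $x_i$ to every other $x_j$; the network may involve other junction points (routes may change from one segment to another wherever segments meet). $\operatorname{len}(G(\mathbf{x}^n))$ is the total length of the network. $\operatorname{ST}(\mathbf{x}^n)$ is the Steiner tree of $\mathbf{x}^n$, that is, the connected network of minimum total length on $\mathbf{x}^n$. For a given network, $\ell(x_i,x_j)$ is the route-length, i.e. the length of the shortest path within the network between $x_i$ and $x_j$, and $|x_i-x_j|$ is Euclidean distance. The excess route length is $$\operatorname{excess}(G(\mathbf{x}^n))=\operatorname{average}_{(i,j)}\bigl(\ell(x_i,x_j)-|x_i-x_j|\bigr),$$ where the average is over all distinct pairs $(i,j)$, $i\ne j$. *)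

theory Defs
  imports "HOL-Analysis.Analysis" "HOL-Library.Landau_Symbols"
begin

type_synonym point = "real^2"

text \<open>A pair \<open>(a, b)\<close> stands for the segment \<open>closed_segment a b\<close>; the network consists of the
  listed segments together with the configuration it is considered on.\<close>

type_synonym network = "(point \<times> point) set"

definition network_length :: "network \<Rightarrow> real" where
  "network_length G = (\<Sum>(a, b)\<in>G. dist a b)"

text \<open>A route is a list of points, each two consecutive ones lying on a common segment, so
  it may change from one segment to another at any common point of the two, including
  crossings of their interiors. The one-point list is the trivial route.\<close>

definition route :: "network \<Rightarrow> point \<Rightarrow> point \<Rightarrow> point list \<Rightarrow> bool" where
  "route G p q ps \<longleftrightarrow> ps \<noteq> [] \<and> hd ps = p \<and> last ps = q \<and>
     successively (\<lambda>u v. \<exists>(a, b)\<in>G. u \<in> closed_segment a b \<and> v \<in> closed_segment a b) ps"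

definition polyline_length :: "point list \<Rightarrow> real" where
  "polyline_length ps = (\<Sum>i<length ps - 1. dist (ps ! i) (ps ! Suc i))"

definition route_length :: "network \<Rightarrow> point \<Rightarrow> point \<Rightarrow> real" where
  "route_length G p q = Inf {polyline_length ps | ps. route G p q ps}"

text \<open>Configurations are indexed families \<open>x 1, \<dots>, x n\<close>; values of \<open>x\<close> at other indices are
  irrelevant.\<close>

definition network_on :: "nat \<Rightarrow> (nat \<Rightarrow> point) \<Rightarrow> network \<Rightarrow> bool" where
  "network_on n x G \<longleftrightarrow> finite G \<and>
     (\<forall>i\<in>{1..n}. \<forall>j\<in>{1..n}. i \<noteq> j \<longrightarrow> (\<exists>ps. route G (x i) (x j) ps))"

definition steiner_tree :: "nat \<Rightarrow> (nat \<Rightarrow> point) \<Rightarrow> network \<Rightarrow> bool" where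
  "steiner_tree n x T \<longleftrightarrow> network_on n x T \<and>
     (\<forall>G. network_on n x G \<longrightarrow> network_length T \<le> network_length G)"

definition excess :: "nat \<Rightarrow> (nat \<Rightarrow> point) \<Rightarrow> network \<Rightarrow> real" where
  "excess n x G =
     (\<Sum>(i, j) \<in> {(i, j). i \<in> {1..n} \<and> j \<in> {1..n} \<and> i \<noteq> j}.
        route_length G (x i) (x j) - dist (x i) (x j))
     / real (card {(i, j). i \<in> {1..n} \<and> j \<in> {1..n} \<and> i \<noteq> j})"

text \<open>Squares need not be axis-parallel.\<close>

definition is_square :: "point set \<Rightarrow> real \<Rightarrow> bool" where
  "is_square Q a \<longleftrightarrow> (\<exists>c u v. norm u = 1 \<and> norm v = 1 \<and> u \<bullet> v = 0 \<and>
     Q = {c + s *\<^sub>R u + t *\<^sub>R v | s t. s \<in> {0..a} \<and> t \<in> {0..a}})"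

end

theory Submission
  imports Defs
begin

text \<open>
  Both parts follow from one construction with a parameter \<open>k\<close>: the Steiner tree is augmented by segments of
  total length \<open>O(n / k)\<close> so that the excess becomes \<open>O(k\<^sup>2 * ln n)\<close> (lemma \<open>short_network\<close>). Constant \<open>k\<close> of order
  \<open>1 / \<epsilon>\<close> gives (b), and \<open>k\<close> growing slowly with \<open>n\<close> gives (a).

  The added segments are long straight lines and short access roads. Consider two points \<open>p\<close> and \<open>q\<close> and the
  lines that pass above both. Their lower envelope is a concave curve, and it is a route. A path that deviates from
  the direction \<open>pq\<close> by a small slope \<open>\<sigma>\<close> is longer by a factor of about \<open>1 + \<sigma>\<^sup>2 / 2\<close> only, since the first
  order terms depend on the end points alone. At distance \<open>d\<close> from the closer end point, lines passing within height
  \<open>sqrt d\<close> with slope within \<open>1 / sqrt d\<close> fill a region of bounded area in the space of lines, so that among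
  \<open>L / k\<close> lines spread at random over a square of side \<open>L = sqrt n\<close> one expects a bounded number of them. They force
  \<open>\<sigma>\<^sup>2 = O(1 / d)\<close>, and the excess is a harmonic sum over \<open>d\<close>, that is \<open>O(ln n)\<close>
  (lemmas \<open>reaches_along_envelope\<close>, \<open>inner_piece_slope\<close>, \<open>reaches_pair\<close>).

  Randomness is replaced by counting. The estimate for one pair is a weighted number of windows in the space of lines
  that contain none of the chosen lines, and the sum of these estimates over all pairs is kept below its mean value by
  choosing the lines one after the other (lemmas \<open>few_points_hit_most\<close>, \<open>few_lines_short_detours\<close>). A coarse grid of
  lines takes over where all windows are empty.

  It remains to get from the points to the lines. An access road at each point would be too long in total. But the
  tree has length \<open>O(n)\<close>, and walking around it shows that \<open>O(n / k\<^sup>2)\<close> of the points come within distance \<open>k\<^sup>2\<close>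
  of every other one, measured along the tree (lemma \<open>sparse_net\<close>). Only these points receive access roads.
\<close>

section \<open>Routes of bounded length\<close>

text \<open>A length budget rather than an infimum: budgets add up under concatenation without any question
  of whether a shortest route exists.\<close>

definition reaches :: "network \<Rightarrow> point \<Rightarrow> point \<Rightarrow> real \<Rightarrow> bool" where
  "reaches G p q l \<longleftrightarrow> (\<exists>ps. route G p q ps \<and> polyline_length ps \<le> l)"

lemma polyline_length_single [simp]: "polyline_length [p] = 0"
  by (simp add: polyline_length_def)

lemma polyline_length_Cons [simp]:
  "polyline_length (p # q # ps) = dist p q + polyline_length (q # ps)"
  unfolding polyline_length_def by (simp add: sum.lessThan_Suc_shift del: sum.lessThan_Suc)

lemma polyline_length_append:
  assumes "ps \<noteq> []" "qs \<noteq> []"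
  shows "polyline_length (ps @ qs) =
    polyline_length ps + dist (last ps) (hd qs) + polyline_length qs"
  using assms(1)
proof (induction ps)
  case (Cons p ps)
  then show ?case using assms(2) by (cases ps; cases qs) auto
qed simp

lemma polyline_length_rev: "polyline_length (rev ps) = polyline_length ps"
proof (induction ps)
  case (Cons p ps)
  then show ?case
    by (cases "ps = []")
      (auto simp: polyline_length_append last_rev dist_commute neq_Nil_conv)
qed simp

lemma polyline_length_nonneg: "polyline_length ps \<ge> 0"
  by (simp add: polyline_length_def sum_nonneg)

lemma reaches_refl: "0 \<le> l \<Longrightarrow> reaches G p p l"
  unfolding reaches_def route_def by (intro exI[of _ "[p]"]) auto

lemma reaches_segment:
  assumes "(a, b) \<in> G" "p \<in> closed_segment a b" "q \<in> closed_segment a b" "dist p q \<le> l"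
  shows "reaches G p q l"
  unfolding reaches_def route_def using assms by (intro exI[of _ "[p, q]"]) auto

lemma reaches_mono:
  assumes "reaches G p q l" "G \<subseteq> H" "l \<le> l'"
  shows "reaches H p q l'"
proof -
  obtain ps where ps: "route G p q ps" "polyline_length ps \<le> l"
    using assms(1) by (auto simp: reaches_def)
  have "route H p q ps"
    using ps(1) assms(2) unfolding route_def by (fast intro: successively_mono)
  then show ?thesis unfolding reaches_def using ps(2) assms(3) by (intro exI[of _ ps]) auto
qed

lemma reaches_sym:
  assumes "reaches G p q l" shows "reaches G q p l"
proof -
  obtain ps where ps: "route G p q ps" "polyline_length ps \<le> l"
    using assms(1) by (auto simp: reaches_def)
  have "route G q p (rev ps)"
    using ps(1) unfolding route_def
    by (auto simp: hd_rev last_rev elim!: successively_mono)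
  then show ?thesis unfolding reaches_def using ps(2)
    by (intro exI[of _ "rev ps"]) (auto simp: polyline_length_rev)
qed

lemma reaches_trans:
  assumes "reaches G p q l" "reaches G q r l'"
  shows "reaches G p r (l + l')"
proof -
  obtain ps where ps: "route G p q ps" "polyline_length ps \<le> l"
    using assms(1) by (auto simp: reaches_def)
  obtain qs where qs: "route G q r qs" "polyline_length qs \<le> l'"
    using assms(2) by (auto simp: reaches_def)
  \<comment> \<open>The joint \<open>q\<close> must not be repeated: a consecutive pair \<open>q, q\<close> would require \<open>q\<close> to
    lie on a segment, which fails for an isolated point.\<close>
  obtain zs where zs: "qs = q # zs"
    using qs(1) unfolding route_def by (cases qs) auto
  show ?thesis
  proof (cases "zs = []")
    case True
    then have "r = q" "0 \<le> l'"
      using qs zs by (auto simp: route_def)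
    then show ?thesis using ps unfolding reaches_def by (intro exI[of _ ps]) auto
  next
    case False
    then obtain z zs' where z: "zs = z # zs'" by (cases zs) auto
    have "route G p r (ps @ zs)"
      using ps(1) qs(1) unfolding route_def zs z
      by (auto simp: successively_append_iff)
    moreover have "polyline_length (ps @ zs) = polyline_length ps + polyline_length qs"
      using ps(1) unfolding zs z route_def by (subst polyline_length_append) auto
    ultimately show ?thesis using ps(2) qs(2) unfolding reaches_def
      by (intro exI[of _ "ps @ zs"]) auto
  qed
qed

lemma route_dist_le_polyline_length:
  assumes "route G p q ps" shows "dist p q \<le> polyline_length ps"
proof -
  have "ps \<noteq> [] \<Longrightarrow> dist (hd ps) (last ps) \<le> polyline_length ps"
  proof (induction ps)
    case (Cons p ps)
    show ?case
    proof (cases ps)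
      case (Cons p' ps')
      have "dist p (last ps) \<le> dist p p' + dist p' (last ps)" by (rule dist_triangle)
      then show ?thesis using Cons Cons.IH by auto
    qed simp
  qed simp
  then show ?thesis using assms by (auto simp: route_def)
qed

lemma route_length_le:
  assumes "reaches G p q l" shows "route_length G p q \<le> l"
proof -
  obtain ps where ps: "route G p q ps" "polyline_length ps \<le> l"
    using assms(1) by (auto simp: reaches_def)
  have "route_length G p q \<le> polyline_length ps"
    unfolding route_length_def
    using ps(1) polyline_length_nonneg by (intro cInf_lower bdd_belowI[of _ 0]) auto
  then show ?thesis using ps(2) by simp
qed

lemma dist_le_route_length:
  assumes "route G p q ps" shows "dist p q \<le> route_length G p q"
  unfolding route_length_def using assms route_dist_le_polyline_length
  by (intro cInf_greatest) auto

lemma reaches_dist: "reaches G p q l \<Longrightarrow> dist p q \<le> l"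
  unfolding reaches_def using route_dist_le_polyline_length order_trans by blast

lemma reaches_ex_route: "reaches G p q l \<Longrightarrow> \<exists>ps. route G p q ps"
  unfolding reaches_def by blast

lemma network_length_nonneg: "network_length G \<ge> 0"
  unfolding network_length_def by (auto intro: sum_nonneg)

lemma network_length_Un_le:
  "finite G \<Longrightarrow> finite H \<Longrightarrow> network_length (G \<union> H) \<le> network_length G + network_length H"
  unfolding network_length_def
  by (subst sum.union_inter[symmetric, of G H]) (auto intro!: sum_nonneg)

lemma network_length_mono: "finite H \<Longrightarrow> G \<subseteq> H \<Longrightarrow> network_length G \<le> network_length H"
  unfolding network_length_def by (rule sum_mono2) auto

lemma network_length_image_le:
  assumes "finite I" "\<And>i. i \<in> I \<Longrightarrow> dist (fst (f i)) (snd (f i)) \<le> l"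
  shows "network_length (f ` I) \<le> real (card I) * l"
proof -
  have "network_length (f ` I) \<le> (\<Sum>i\<in>I. dist (fst (f i)) (snd (f i)))"
    unfolding network_length_def case_prod_beta using assms(1)
    by (intro order_trans[OF sum_image_le]) auto
  also have "\<dots> \<le> real (card I) * l" using assms(2) by (rule sum_bounded_above)
  finally show ?thesis .
qed

section \<open>A sparse net of points along a network\<close>

lemma dist_on_segment:
  fixes a b p :: point
  assumes "p \<in> closed_segment a b" shows "dist a p + dist p b = dist a b"
  using assms between between_mem_segment by metis

lemma segment_dist_from_end:
  fixes a b p q :: point
  assumes "p \<in> closed_segment a b" "q \<in> closed_segment a b"
  shows "dist p q = \<bar>dist a p - dist a q\<bar>"
proof -
  obtain s where s: "p = a + s *\<^sub>R (b - a)" "0 \<le> s" "s \<le> 1"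
    using assms(1) by (auto simp: in_segment algebra_simps)
  obtain t where t: "q = a + t *\<^sub>R (b - a)" "0 \<le> t" "t \<le> 1"
    using assms(2) by (auto simp: in_segment algebra_simps)
  have "p - q = (s - t) *\<^sub>R (b - a)" by (simp add: s t algebra_simps)
  then have "dist p q = \<bar>s - t\<bar> * norm (b - a)" by (simp add: dist_norm)
  moreover have "dist a p = s * norm (b - a)" "dist a q = t * norm (b - a)"
    using s t by (auto simp: dist_norm)
  ultimately show ?thesis by (simp add: left_diff_distrib[symmetric] abs_mult)
qed

text \<open>A substitute for walking around a tree and back: every point of \<open>F\<close> gets a time in \<open>[0, T]\<close>,
  and points visited at nearby times are close within the network. Only one time per point is
  recorded, so that no closed walk has to be constructed.\<close>

definition linearises :: "network \<Rightarrow> point set \<Rightarrow> (point \<Rightarrow> real) \<Rightarrow> real \<Rightarrow> bool" where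
  "linearises G F \<tau> T \<longleftrightarrow>
     (\<forall>p\<in>F. 0 \<le> \<tau> p \<and> \<tau> p \<le> T) \<and> (\<forall>p\<in>F. \<forall>q\<in>F. reaches G p q \<bar>\<tau> p - \<tau> q\<bar>)"

text \<open>At time \<open>\<tau> w\<close> a side trip \<open>w \<rightarrow> a \<rightarrow> b \<rightarrow> w\<close> of length \<open>2 * dist a b\<close> is inserted and all later
  visits are postponed by that amount. A point \<open>p\<close> of the new segment is visited on the stretch from
  \<open>a\<close> to \<open>b\<close>; by the triangle inequality the time left before and after that visit suffices to
  come from \<open>w\<close> and to return to it.\<close>

lemma linearises_insert_segment:
  assumes lin: "linearises G F \<tau> T" and w: "w \<in> F" "w \<in> closed_segment a b"
    and ab: "(a, b) \<in> G" and S: "S \<subseteq> closed_segment a b"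
  shows "\<exists>\<tau>'. linearises G (F \<union> S) \<tau>' (T + 2 * dist a b)"
proof -
  define t where "t p = dist w a + dist a p" for p
  define \<tau>' where "\<tau>' p =
    (if p \<in> F then if \<tau> p \<le> \<tau> w then \<tau> p else \<tau> p + 2 * dist a b else \<tau> w + t p)" for p
  have \<tau>: "0 \<le> \<tau> p" "\<tau> p \<le> T" if "p \<in> F" for p using lin that by (auto simp: linearises_def)
  have r: "reaches G p q \<bar>\<tau> p - \<tau> q\<bar>" if "p \<in> F" "q \<in> F" for p q
    using lin that by (auto simp: linearises_def)
  have t1: "dist w p \<le> t p" for p unfolding t_def by (rule dist_triangle)
  have t2: "t p \<le> 2 * dist a b - dist w p" if "p \<in> closed_segment a b" for p
  proof -
    have "dist a p + dist p b = dist a b" "dist a w + dist w b = dist a b"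
      using dist_on_segment w(2) that by auto
    moreover have "dist w p \<le> dist w b + dist p b" by (rule dist_triangle2)
    ultimately show ?thesis unfolding t_def by (simp add: dist_commute)
  qed
  have FS: "reaches G p q \<bar>\<tau>' p - \<tau>' q\<bar>" if p: "p \<in> F" and q: "q \<in> S" "q \<notin> F" for p q
  proof -
    have q': "q \<in> closed_segment a b" using q S by auto
    have "reaches G w q (dist w q)" using reaches_segment[OF ab w(2) q'] by simp
    then have "reaches G p q (\<bar>\<tau> p - \<tau> w\<bar> + dist w q)" using reaches_trans r p w(1) by blast
    moreover have "\<bar>\<tau> p - \<tau> w\<bar> + dist w q \<le> \<bar>\<tau>' p - \<tau>' q\<bar>"
      using p q t1[of q] t2[OF q'] zero_le_dist[of w q] unfolding \<tau>'_def by auto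
    ultimately show ?thesis using reaches_mono by blast
  qed
  have "reaches G p q \<bar>\<tau>' p - \<tau>' q\<bar>" if p: "p \<in> F \<union> S" and q: "q \<in> F \<union> S" for p q
  proof -
    consider "p \<in> F" "q \<in> F" | "p \<in> F" "q \<notin> F" | "p \<notin> F" "q \<in> F" | "p \<notin> F" "q \<notin> F" by blast
    then show ?thesis
    proof cases
      case 1
      have "\<bar>\<tau> p - \<tau> q\<bar> \<le> \<bar>\<tau>' p - \<tau>' q\<bar>"
        using 1 zero_le_dist[of a b] unfolding \<tau>'_def by (auto simp del: zero_le_dist)
      then show ?thesis using r[OF 1] reaches_mono by blast
    next
      case 2 then show ?thesis using FS q by auto
    next
      case 3 then have "reaches G q p \<bar>\<tau>' q - \<tau>' p\<bar>" using FS p by auto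
      then show ?thesis using reaches_sym by (simp add: abs_minus_commute)
    next
      case 4
      then have s: "p \<in> closed_segment a b" "q \<in> closed_segment a b" using p q S by auto
      have "dist p q \<le> \<bar>\<tau>' p - \<tau>' q\<bar>"
        using 4 unfolding \<tau>'_def t_def by (simp add: segment_dist_from_end[OF s])
      then show ?thesis using reaches_segment[OF ab s] by blast
    qed
  qed
  moreover have "0 \<le> \<tau>' p \<and> \<tau>' p \<le> T + 2 * dist a b" if "p \<in> F \<union> S" for p
  proof (cases "p \<in> F")
    case True
    then show ?thesis using \<tau>[OF True] zero_le_dist[of a b] unfolding \<tau>'_def
      by (auto simp del: zero_le_dist)
  next
    case False
    then have "p \<in> closed_segment a b" using that S by auto
    then show ?thesis using \<tau>[OF w(1)] t1[of p] t2[of p] False zero_le_dist[of w p]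
      unfolding \<tau>'_def by (simp del: zero_le_dist)
  qed
  ultimately show ?thesis unfolding linearises_def by blast
qed

text \<open>Doubling every segment of a connected network gives a closed walk through all of it. Segments that
  cannot be reached from \<open>z\<close> must be left alone; a maximal set of segments that can be walked
  automatically contains every segment touching the part walked so far, hence
  everything reachable.\<close>

lemma linearisation:
  assumes fin: "finite G" "finite F" and conn: "\<And>p. p \<in> F \<Longrightarrow> \<exists>ps. route G z p ps"
  shows "\<exists>\<tau>. linearises G F \<tau> (2 * network_length G)"
proof -
  define pts where "pts C = insert z (\<Union>(a, b)\<in>C. closed_segment a b)" for C :: network
  define good where "good C \<longleftrightarrow> C \<subseteq> G \<and>
    (\<forall>E. finite E \<and> E \<subseteq> pts C \<longrightarrow> (\<exists>\<tau>. linearises G E \<tau> (2 * network_length C)))" for C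
  have "good {}" unfolding good_def
  proof (intro conjI allI impI)
    fix E assume "finite E \<and> E \<subseteq> pts {}"
    then have "linearises G E (\<lambda>_. 0) (2 * network_length {})"
      by (auto simp: linearises_def pts_def network_length_def intro!: reaches_refl)
    then show "\<exists>\<tau>. linearises G E \<tau> (2 * network_length {})" by blast
  qed simp
  moreover have "{C. good C} \<subseteq> Pow G" by (auto simp: good_def)
  then have "finite {C. good C}" using fin(1) finite_subset by blast
  ultimately obtain C where C: "good C" and max: "\<And>D. good D \<Longrightarrow> C \<subseteq> D \<Longrightarrow> D = C"
    using finite_has_maximal[of "{C. good C}"] by blast
  have CG: "C \<subseteq> G" and finC: "finite C" using C fin(1) finite_subset by (auto simp: good_def)
  \<comment> \<open>Maximality: a segment of \<open>G\<close> that meets the points reached by \<open>C\<close> can be inserted into the walk.\<close>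
  have closed: "(a, b) \<in> C"
    if w: "w \<in> pts C" "w \<in> closed_segment a b" and ab: "(a, b) \<in> G" for a b w
  proof (rule ccontr)
    assume new: "(a, b) \<notin> C"
    have "good (insert (a, b) C)" unfolding good_def
    proof (intro conjI allI impI)
      show "insert (a, b) C \<subseteq> G" using CG ab by simp
      fix E assume E: "finite E \<and> E \<subseteq> pts (insert (a, b) C)"
      define E1 where "E1 = insert w (E \<inter> pts C)"
      have "finite E1" "E1 \<subseteq> pts C" using E w(1) by (auto simp: E1_def)
      then obtain \<tau> where "linearises G E1 \<tau> (2 * network_length C)"
        using C unfolding good_def by blast
      from linearises_insert_segment[OF this _ w(2) ab, of "E - pts C"]
      obtain \<tau>' where \<tau>': "linearises G (E1 \<union> (E - pts C)) \<tau>' (2 * network_length C + 2 * dist a b)"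
        using E by (auto simp: E1_def pts_def)
      have len: "network_length (insert (a, b) C) = dist a b + network_length C"
        using finC new unfolding network_length_def by simp
      have "E \<subseteq> E1 \<union> (E - pts C)" by (auto simp: E1_def)
      with \<tau>' have "linearises G E \<tau>' (2 * network_length (insert (a, b) C))"
        unfolding linearises_def len by (auto simp: algebra_simps)
      then show "\<exists>\<tau>. linearises G E \<tau> (2 * network_length (insert (a, b) C))" by blast
    qed
    from max[OF this] new show False by auto
  qed
  have reach: "last ps \<in> pts C"
    if "ps \<noteq> []" "hd ps \<in> pts C"
      "successively (\<lambda>u v. \<exists>(a, b)\<in>G. u \<in> closed_segment a b \<and> v \<in> closed_segment a b) ps"
    for ps using that
  proof (induction ps)
    case (Cons p ps)
    show ?case
    proof (cases ps)
      case Nil then show ?thesis using Cons by simp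
    next
      case (Cons q qs)
      then obtain a b where ab: "(a, b) \<in> G" "p \<in> closed_segment a b" "q \<in> closed_segment a b"
        using Cons.prems by auto
      then have "(a, b) \<in> C" using closed Cons.prems by auto
      then have "q \<in> pts C" using ab by (auto simp: pts_def)
      then show ?thesis using Cons.IH Cons.prems Cons by auto
    qed
  qed simp
  have "F \<subseteq> pts C"
  proof
    fix p assume "p \<in> F"
    then obtain ps where "route G z p ps" using conn by blast
    then show "p \<in> pts C" using reach[of ps] by (auto simp: route_def pts_def)
  qed
  then obtain \<tau> where "linearises G F \<tau> (2 * network_length C)"
    using C fin(2) by (auto simp: good_def)
  moreover have "network_length C \<le> network_length G" using CG fin(1) network_length_mono by blast
  ultimately have "linearises G F \<tau> (2 * network_length G)"
    unfolding linearises_def by fastforce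
  then show ?thesis by blast
qed

text \<open>Cut the time interval into pieces of duration \<open>K\<close> and let one point represent each piece. The number
  of representatives does not depend on the number of points; this is
  what makes it affordable to build a private access road for each of them.\<close>

lemma sparse_net:
  assumes "finite G" "finite F" "\<And>p. p \<in> F \<Longrightarrow> \<exists>ps. route G z p ps" and "K > 0"
  shows "\<exists>r. r ` F \<subseteq> F \<and> real (card (r ` F)) \<le> 2 * network_length G / K + 1 \<and>
    (\<forall>p\<in>F. reaches G p (r p) K)"
proof -
  obtain \<tau> where \<tau>: "linearises G F \<tau> (2 * network_length G)"
    using linearisation assms by blast
  define bucket where "bucket p = nat \<lfloor>\<tau> p / K\<rfloor>" for p
  define pick where "pick m = (SOME p. p \<in> F \<and> bucket p = m)" for m
  have pick: "pick (bucket p) \<in> F" "bucket (pick (bucket p)) = bucket p" if "p \<in> F" for p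
    using someI[of "\<lambda>q. q \<in> F \<and> bucket q = bucket p" p] that by (auto simp: pick_def)
  define r where "r = pick \<circ> bucket"
  have "bucket ` F \<subseteq> {..nat \<lfloor>2 * network_length G / K\<rfloor>}"
    using \<tau> \<open>K > 0\<close> unfolding linearises_def bucket_def
    by (auto intro!: nat_mono floor_mono divide_right_mono)
  then have "card (bucket ` F) \<le> card {..nat \<lfloor>2 * network_length G / K\<rfloor>}"
    by (intro card_mono) auto
  then have "card (bucket ` F) \<le> nat \<lfloor>2 * network_length G / K\<rfloor> + 1" by simp
  moreover have "card (r ` F) \<le> card (bucket ` F)"
    unfolding r_def image_comp[symmetric] using assms(2) by (intro card_image_le) auto
  moreover have "real (nat \<lfloor>2 * network_length G / K\<rfloor>) \<le> 2 * network_length G / K"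
    using network_length_nonneg[of G] \<open>K > 0\<close> by (simp add: of_nat_nat)
  ultimately have "real (card (r ` F)) \<le> 2 * network_length G / K + 1" by linarith
  moreover have "reaches G p (r p) K" if p: "p \<in> F" for p
  proof -
    have q: "r p \<in> F" "bucket (r p) = bucket p" using pick[OF p] by (auto simp: r_def)
    have "0 \<le> \<tau> p / K" "0 \<le> \<tau> (r p) / K" using \<tau> p q(1) \<open>K > 0\<close> by (auto simp: linearises_def)
    then have "\<lfloor>\<tau> p / K\<rfloor> = \<lfloor>\<tau> (r p) / K\<rfloor>" using q(2) unfolding bucket_def
      by (metis nat_0_le zero_le_floor)
    then have "\<bar>\<tau> p / K - \<tau> (r p) / K\<bar> \<le> 1" by linarith
    then have "\<bar>\<tau> p - \<tau> (r p)\<bar> \<le> K"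
      using \<open>K > 0\<close> by (simp add: diff_divide_distrib[symmetric] abs_le_iff field_simps)
    moreover have "reaches G p (r p) \<bar>\<tau> p - \<tau> (r p)\<bar>"
      using \<tau> p q(1) unfolding linearises_def by blast
    ultimately show ?thesis using reaches_mono by blast
  qed
  ultimately show ?thesis using pick unfolding r_def by (intro exI[of _ r]) (auto simp: r_def)
qed

section \<open>Routes along the lower envelope of lines\<close>

text \<open>A pair \<open>(a, b)\<close> is the line \<open>y = a + b * x\<close>. In these coordinates the shear that makes a given
  pair of points horizontal is a translation of the parameter \<open>b\<close>, so that lines of all slopes can be
  compared to a pair of any direction in the same parameter space.\<close>

definition height :: "real \<times> real \<Rightarrow> real \<Rightarrow> real" where
  "height l x = fst l + snd l * x"

definition envelope :: "(real \<times> real) set \<Rightarrow> real \<Rightarrow> real" where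
  "envelope F x = Min ((\<lambda>l. height l x) ` F)"

lemma height_shift: "height l y = height l x + snd l * (y - x)"
  by (simp add: height_def algebra_simps)

lemma envelope_le: "finite F \<Longrightarrow> l \<in> F \<Longrightarrow> envelope F x \<le> height l x"
  unfolding envelope_def by (auto intro: Min_le)

lemma envelope_attained:
  assumes "finite F" "F \<noteq> {}" shows "\<exists>l\<in>F. height l x = envelope F x"
proof -
  have "envelope F x \<in> (\<lambda>l. height l x) ` F"
    unfolding envelope_def using assms by (intro Min_in) auto
  then show ?thesis by auto
qed

lemma envelope_eqI:
  assumes "finite F" "l \<in> F" "\<And>l'. l' \<in> F \<Longrightarrow> height l x \<le> height l' x"
  shows "height l x = envelope F x"
proof -
  have "height l x \<le> envelope F x"
    unfolding envelope_def using assms by (subst Min_ge_iff) auto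
  then show ?thesis using envelope_le[OF assms(1,2), of x] by simp
qed

text \<open>The length of a path is compared to that of the straight line of slope \<open>m\<close>. The term
  linear in \<open>b - m\<close> depends only on the end points of the path once it is integrated, so the
  true cost of deviating is quadratic. It follows from \<open>2 * z * c \<le> z\<^sup>2 + c\<^sup>2\<close> for the two square
  roots.\<close>

lemma sqrt_tilt_le:
  fixes m b :: real
  shows "sqrt (1 + b^2) \<le>
    sqrt (1 + m^2) + m / sqrt (1 + m^2) * (b - m) + (b - m)^2 / 2"
proof -
  define c where "c = sqrt (1 + m^2)"
  have c: "c \<ge> 1" "c^2 = 1 + m^2" by (auto simp: c_def)
  define z where "z = sqrt (1 + b^2)"
  have z: "z^2 = 1 + b^2" by (simp add: z_def)
  have "0 \<le> (z - c)^2" by simp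
  then have "2 * c * z \<le> (1 + b^2) + (1 + m^2)"
    unfolding z[symmetric] c(2)[symmetric] by (simp add: power2_diff ac_simps)
  also have "\<dots> = 2 * c^2 + 2 * m * (b - m) + (b - m)^2"
    unfolding c(2) by (simp add: power2_eq_square algebra_simps)
  also have "\<dots> = 2 * c * (c + m / c * (b - m) + (b - m)^2 / (2 * c))"
    using c(1) by (simp add: field_simps power2_eq_square)
  finally have "z \<le> c + m / c * (b - m) + (b - m)^2 / (2 * c)"
    using c(1) by (simp add: mult_le_cancel_left)
  moreover have "(b - m)^2 / (2 * c) \<le> (b - m)^2 / 2"
    using c(1) by (intro divide_left_mono) auto
  ultimately show ?thesis unfolding z_def c_def by linarith
qed

text \<open>Coordinates along two adjacent sides of a square of side \<open>L\<close>. Interchanging \<open>u\<close> and \<open>v\<close> gives another such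
  frame, which is how the mirror image of a family of lines is obtained.\<close>

locale square_frame =
  fixes c u v :: point and L :: real
  assumes unit: "norm u = 1" "norm v = 1" "u \<bullet> v = 0" and L_pos: "L > 0"
begin

definition pt :: "real \<Rightarrow> real \<Rightarrow> point" where
  "pt x y = c + x *\<^sub>R u + y *\<^sub>R v"

definition track :: "real \<times> real \<Rightarrow> point \<times> point" where
  "track l = (pt 0 (height l 0), pt L (height l L))"

lemma dist_pt: "dist (pt x y) (pt x' y') = sqrt ((x - x')^2 + (y - y')^2)"
proof -
  have "pt x y - pt x' y' = (x - x') *\<^sub>R u + (y - y') *\<^sub>R v"
    by (simp add: pt_def algebra_simps)
  moreover have "norm ((x - x') *\<^sub>R u + (y - y') *\<^sub>R v)^2 = (x - x')^2 + (y - y')^2"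
    using unit unfolding power2_norm_eq_inner
    by (simp add: inner_add_left inner_add_right inner_commute[of v u] power2_eq_square norm_eq_1)
  ultimately show ?thesis
    by (metis dist_norm norm_ge_zero real_sqrt_pow2_iff real_sqrt_unique)
qed

lemma pt_on_track:
  assumes "0 \<le> x" "x \<le> L"
  shows "pt x (height l x) \<in> closed_segment (fst (track l)) (snd (track l))"
proof -
  define t where "t = x / L"
  have t: "0 \<le> t" "t \<le> 1" "x = t * L" using assms L_pos by (auto simp: t_def)
  have "pt x (height l x) = (1 - t) *\<^sub>R pt 0 (height l 0) + t *\<^sub>R pt L (height l L)"
    by (simp add: pt_def height_def t(3) algebra_simps)
  then show ?thesis using t unfolding track_def in_segment by auto
qed

lemma pt_on_riser:
  assumes "y \<le> y'" "y' \<le> y + k"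
  shows "pt x y' \<in> closed_segment (pt x y) (pt x (y + k))"
proof (cases "k = 0")
  case True then show ?thesis using assms by simp
next
  case False
  define t where "t = (y' - y) / k"
  have t: "0 \<le> t" "t \<le> 1" "y' = y + t * k" using assms False by (auto simp: t_def)
  have "pt x y' = (1 - t) *\<^sub>R pt x y + t *\<^sub>R pt x (y + k)"
    by (simp add: pt_def t(3) algebra_simps)
  then show ?thesis using t unfolding in_segment by auto
qed

text \<open>The potential \<open>W\<close> collects the three terms of the previous estimate, so that lengths
  telescope. The route follows one line until another line of smaller slope passes below it and changes to
  that line there; the slope strictly decreases, which bounds the number of changes.\<close>

lemma reaches_along_envelope:
  fixes m s :: real
  defines "W \<equiv> \<lambda>F x. x * sqrt (1 + m^2) + m / sqrt (1 + m^2) * (envelope F x - m * x) + x * s^2 / 2"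
  assumes F: "finite F" "F \<noteq> {}" "track ` F \<subseteq> G"
    and x: "0 \<le> x0" "x0 \<le> x1" "x1 \<le> L"
    and slope: "\<And>x l. x \<in> {x0..x1} \<Longrightarrow> l \<in> F \<Longrightarrow> height l x = envelope F x \<Longrightarrow> \<bar>snd l - m\<bar> \<le> s"
  shows "reaches G (pt x0 (envelope F x0)) (pt x1 (envelope F x1)) (W F x1 - W F x0)"
proof -
  have straight: "reaches G (pt y0 (envelope F y0)) (pt y1 (envelope F y1)) (W F y1 - W F y0)"
    if y: "x0 \<le> y0" "y0 \<le> y1" "y1 \<le> x1" and l: "l \<in> F"
      and e: "height l y0 = envelope F y0" "height l y1 = envelope F y1" for l y0 y1
  proof -
    define b where "b = snd l"
    have diff: "envelope F y1 - envelope F y0 = b * (y1 - y0)"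
      unfolding e[symmetric] b_def height_def by (simp add: algebra_simps)
    have "dist (pt y0 (envelope F y0)) (pt y1 (envelope F y1))
      = sqrt ((y1 - y0)^2 + (b * (y1 - y0))^2)"
      unfolding dist_pt diff[symmetric] by (simp add: power2_commute)
    also have "(y1 - y0)^2 + (b * (y1 - y0))^2 = (y1 - y0)^2 * (1 + b^2)"
      unfolding power_mult_distrib by (simp add: distrib_left)
    also have "sqrt \<dots> = (y1 - y0) * sqrt (1 + b^2)"
      using y by (simp add: real_sqrt_mult)
    also have "\<dots> \<le> (y1 - y0) * (sqrt (1 + m^2) + m / sqrt (1 + m^2) * (b - m) + s^2 / 2)"
    proof -
      have "\<bar>b - m\<bar> \<le> s" using slope[of y0 l] y l e unfolding b_def by auto
      then have "\<bar>b - m\<bar>^2 \<le> s^2" by (intro power_mono) auto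
      then have "(b - m)^2 \<le> s^2" by simp
      then show ?thesis using sqrt_tilt_le[of b m] y by (intro mult_left_mono) auto
    qed
    also have "\<dots> = (y1 - y0) * sqrt (1 + m^2)
        + m / sqrt (1 + m^2) * (b * (y1 - y0) - m * (y1 - y0)) + (y1 - y0) * s^2 / 2"
    proof -
      have "w * (C + r * (b - m) + z / 2) = w * C + r * (b * w - m * w) + w * z / 2" for w C r z :: real
        by (simp add: algebra_simps)
      then show ?thesis .
    qed
    also have "\<dots> = W F y1 - W F y0"
    proof -
      define r where "r = m / sqrt (1 + m^2)"
      show ?thesis unfolding W_def diff[symmetric] r_def[symmetric]
        by (simp add: algebra_simps diff_divide_distrib)
    qed
    finally have "dist (pt y0 (envelope F y0)) (pt y1 (envelope F y1)) \<le> W F y1 - W F y0" .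
    moreover have "(fst (track l), snd (track l)) \<in> G" using F(3) l by auto
    moreover have "pt y0 (envelope F y0) \<in> closed_segment (fst (track l)) (snd (track l))"
      "pt y1 (envelope F y1) \<in> closed_segment (fst (track l)) (snd (track l))"
      using pt_on_track[of y0 l] pt_on_track[of y1 l] x y e by auto
    ultimately show ?thesis using reaches_segment by blast
  qed
  have "reaches G (pt y (envelope F y)) (pt x1 (envelope F x1)) (W F x1 - W F y)"
    if "x0 \<le> y" "y \<le> x1" "l \<in> F" "height l y = envelope F y" for l y
    using that
  proof (induction "card {l' \<in> F. snd l' < snd l}" arbitrary: l y rule: less_induct)
    case less
    define S where "S = {l' \<in> F. snd l' < snd l \<and> height l' x1 < height l x1}"
    have finS: "finite S" using F(1) by (simp add: S_def)
    have above: "height l z \<le> height l' z"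
      if "l' \<in> F" "snd l \<le> snd l'" "y \<le> z" for l' z
    proof -
      have "height l y \<le> height l' y" using envelope_le[OF F(1) that(1), of y] less.prems by simp
      moreover have "snd l * (z - y) \<le> snd l' * (z - y)" using that by (intro mult_right_mono) auto
      ultimately show ?thesis by (simp add: height_shift[of _ z y])
    qed
    have before: "height l z \<le> height l' z"
      if "snd l' \<le> snd l" "height l t \<le> height l' t" "z \<le> t" for l' z t
    proof -
      have "snd l' * (t - z) \<le> snd l * (t - z)" using that by (intro mult_right_mono) auto
      then show ?thesis using that by (simp add: height_shift[of _ t z])
    qed
    show ?case
    proof (cases "S = {}")
      case True
      have "height l x1 = envelope F x1"
      proof (rule envelope_eqI[OF F(1)])
        fix l' assume l': "l' \<in> F"
        show "height l x1 \<le> height l' x1"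
        proof (cases "snd l' < snd l")
          case True
          then show ?thesis using \<open>S = {}\<close> l' not_less unfolding S_def by blast
        next
          case False
          then show ?thesis using above l' less.prems by simp
        qed
      qed (use less in auto)
      then show ?thesis using straight less.prems by blast
    next
      case False
      define cross where "cross l' = (fst l' - fst l) / (snd l - snd l')" for l' :: "real \<times> real"
      \<comment> \<open>The first place where a line that is lower at \<open>x1\<close> takes over.\<close>
      define z where "z = Min (cross ` S)"
      have "z \<in> cross ` S" unfolding z_def using finS False by (intro Min_in) auto
      then obtain l1 where l1: "l1 \<in> S" "z = cross l1" by auto
      have meet: "height l (cross l') = height l' (cross l')" if "l' \<in> S" for l'
        using that unfolding S_def height_def cross_def by (auto simp: field_simps)
      have le_z: "z \<le> cross l'" if "l' \<in> S" for l' using that finS by (simp add: z_def)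
      have yz: "y \<le> z"
      proof (rule ccontr)
        assume "\<not> y \<le> z"
        then have "snd l1 * (y - z) < snd l * (y - z)" using l1 by (auto simp: S_def)
        then have "height l1 y < height l y"
          using meet[OF l1(1)] l1(2) by (simp add: height_shift[of _ y z])
        moreover have "height l y \<le> height l1 y"
          using envelope_le[OF F(1), of l1 y] l1 less.prems by (simp add: S_def)
        ultimately show False by simp
      qed
      have zx: "z \<le> x1"
      proof (rule ccontr)
        assume "\<not> z \<le> x1"
        then have "height l x1 \<le> height l1 x1"
          using before[of l1 z x1] meet[OF l1(1)] l1 by (auto simp: S_def)
        then show False using l1 by (auto simp: S_def)
      qed
      have ez: "height l z = envelope F z"
      proof (rule envelope_eqI[OF F(1)])
        fix l' assume l': "l' \<in> F"
        consider "snd l \<le> snd l'" | "l' \<in> S" | "snd l' < snd l" "height l x1 \<le> height l' x1"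
          using l' by (fastforce simp: S_def)
        then show "height l z \<le> height l' z"
        proof cases
          case 1 then show ?thesis using above l' yz by auto
        next
          case 2 then show ?thesis
            using before[of l' "cross l'" z] meet le_z by (auto simp: S_def)
        next
          case 3 then show ?thesis using before[of l' x1 z] zx by auto
        qed
      qed (use less in auto)
      have "{l' \<in> F. snd l' < snd l1} \<subset> {l' \<in> F. snd l' < snd l}"
        using l1(1) by (auto simp: S_def)
      then have "card {l' \<in> F. snd l' < snd l1} < card {l' \<in> F. snd l' < snd l}"
        using F(1) by (intro psubset_card_mono) auto
      moreover have "height l1 z = envelope F z" using meet[OF l1(1)] l1(2) ez by simp
      ultimately have "reaches G (pt z (envelope F z)) (pt x1 (envelope F x1)) (W F x1 - W F z)"
        using less.hyps[of l1 z] less.prems yz zx l1 by (auto simp: S_def)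
      moreover have "reaches G (pt y (envelope F y)) (pt z (envelope F z)) (W F z - W F y)"
        using straight[of y z l] less.prems yz zx ez by auto
      ultimately show ?thesis using reaches_trans by fastforce
    qed
  qed
  then show ?thesis using envelope_attained[OF F(1,2), of x0] x by blast
qed

end

text \<open>If the lines of \<open>F\<close> pass above both end points, then a line that is both low at \<open>x\<close> and steep
  would run below \<open>p\<close> or below \<open>q\<close>. So a low envelope is also a flat one. The parameter \<open>m\<close>
  is the slope of the segment from \<open>p\<close> to \<open>q\<close>.\<close>

lemma active_slope_le:
  fixes m r d :: real
  assumes F: "finite F" "\<And>l. l \<in> F \<Longrightarrow> py \<le> height l px" "\<And>l. l \<in> F \<Longrightarrow> qy \<le> height l qx"
    and m: "qy = py + m * (qx - px)"
    and low: "l0 \<in> F" "height l0 x \<le> py + m * (x - px) + r"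
    and d: "0 < d" "d \<le> x - px" "d \<le> qx - x"
    and l: "l \<in> F" "height l x = envelope F x"
  shows "\<bar>snd l - m\<bar> \<le> r / d"
proof -
  define g where "g = height l x - (py + m * (x - px))"
  have "g \<le> r" using envelope_le[OF F(1) low(1), of x] low(2) l unfolding g_def by linarith
  have 1: "(snd l - m) * (x - px) \<le> g"
    using F(2)[OF l(1)] unfolding g_def height_shift[of l x px] by (simp add: algebra_simps)
  have 2: "(m - snd l) * (qx - x) \<le> g"
    using F(3)[OF l(1)] unfolding g_def m height_shift[of l qx x] by (simp add: algebra_simps)
  have "\<bar>snd l - m\<bar> * d \<le> r"
  proof (cases "snd l \<ge> m")
    case True
    have "(snd l - m) * d \<le> (snd l - m) * (x - px)" using True d by (intro mult_left_mono) auto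
    then show ?thesis using 1 \<open>g \<le> r\<close> True by linarith
  next
    case False
    have "(m - snd l) * d \<le> (m - snd l) * (qx - x)" using False d by (intro mult_left_mono) auto
    then have "(m - snd l) * d \<le> r" using 2 \<open>g \<le> r\<close> by linarith
    then show ?thesis using False by (simp add: abs_if)
  qed
  then show ?thesis using d by (simp add: field_simps)
qed

section \<open>Pieces of a journey and the lines that serve them\<close>

definition window :: "real \<Rightarrow> real \<Rightarrow> real \<Rightarrow> real \<Rightarrow> real \<Rightarrow> (real \<times> real) set" where
  "window x y b w h = {l. b \<le> snd l \<and> snd l \<le> b + w \<and> y \<le> height l x \<and> height l x \<le> y + h}"

text \<open>The stretch between \<open>p\<close> and \<open>q\<close>, of horizontal extent \<open>X\<close>, is cut into pieces of equal width, at
  most 1; piece \<open>j\<close> has \<open>end_gap X j\<close> pieces between itself and the closer end. The two pieces next to each end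
  are excluded from \<open>inner_pieces\<close>; they are charged a constant.\<close>

definition pieces :: "real \<Rightarrow> nat" where
  "pieces X = nat \<lceil>X\<rceil>"

definition end_gap :: "real \<Rightarrow> nat \<Rightarrow> nat" where
  "end_gap X j = min j (pieces X - 1 - j)"

definition inner_pieces :: "real \<Rightarrow> nat set" where
  "inner_pieces X = {2..<pieces X - 2}"

definition end_dist :: "real \<Rightarrow> nat \<Rightarrow> real" where
  "end_dist X j = real (end_gap X j) * (X / real (pieces X))"

text \<open>At distance \<open>d\<close> from the closer end the natural scale of deviation is \<open>sqrt d\<close> in height and
  \<open>1 / sqrt d\<close> in slope: it costs a bounded amount over a length \<open>d\<close>, and the lines within it occupy an area in
  parameter space that does not depend on \<open>d\<close>. Level \<open>i\<close> relaxes both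
  by the factor \<open>sqrt i\<close>, giving area \<open>i\<close>. Requiring the slope to be at least that of \<open>pq\<close> when
  starting from \<open>p\<close> (at most, when starting from \<open>q\<close>) makes every guide pass above both points.\<close>

definition guides :: "real \<times> real \<Rightarrow> real \<times> real \<Rightarrow> nat \<Rightarrow> nat \<Rightarrow> (real \<times> real) set" where
  "guides p q j i =
     (let X = fst q - fst p; m = (snd q - snd p) / X; d = end_dist X j; h = sqrt (real i * d)
      in if j \<le> pieces X - 1 - j then window (fst p) (snd p) m (h / d) h
         else window (fst q) (snd q) (m - h / d) (h / d) h)"

text \<open>The restriction to levels \<open>i \<le> d\<close> keeps the relative slope of every guide at most 1. If all of them are missed,
  their number is so large that the trivial slope bound is affordable.\<close>

definition missed_levels ::
    "(real \<times> real) set \<Rightarrow> real \<times> real \<Rightarrow> real \<times> real \<Rightarrow> nat \<Rightarrow> nat set" where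
  "missed_levels F p q j = {i \<in> {1..nat \<lfloor>end_dist (fst q - fst p) j\<rfloor>}. F \<inter> guides p q j i = {}}"

text \<open>The excess length incurred on the inner pieces, in a form that is linear in the
  events that a certain level is missed; the average over all pairs can then be controlled by counting.\<close>

definition detour :: "(real \<times> real) set \<Rightarrow> real \<times> real \<Rightarrow> real \<times> real \<Rightarrow> real" where
  "detour F p q = (\<Sum>j\<in>inner_pieces (fst q - fst p).
     9 / (2 * real (end_gap (fst q - fst p) j)) * (1 + real (card (missed_levels F p q j))))"

lemma pieces_pos: "X > 0 \<Longrightarrow> pieces X > 0"
  and pieces_ge: "X \<le> real (pieces X)"
  unfolding pieces_def by linarith+

text \<open>A line that starts at most \<open>h\<close> above \<open>p\<close> and rises away from \<open>pq\<close> at rate at most \<open>h / d\<close> gains at most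
  \<open>2 * h\<close> over the distance \<open>2 * d\<close>, which leaves room for a piece that begins at distance \<open>d\<close>.\<close>

lemma window_left:
  assumes l: "l \<in> window px py m (h / d) h" and q: "qy = py + m * (qx - px)" "px \<le> qx"
    and "0 < d" "0 \<le> h"
  shows "py \<le> height l px" "qy \<le> height l qx"
    and "px \<le> x \<Longrightarrow> x - px \<le> 2 * d \<Longrightarrow> height l x \<le> py + m * (x - px) + 3 * h"
proof -
  have l': "m \<le> snd l" "snd l \<le> m + h / d" "py \<le> height l px" "height l px \<le> py + h"
    using l by (auto simp: window_def)
  show "py \<le> height l px" by fact
  have "m * (qx - px) \<le> snd l * (qx - px)" using l' q by (intro mult_right_mono) auto
  then show "qy \<le> height l qx" using l' q by (simp add: height_shift[of l qx px])
  assume x: "px \<le> x" "x - px \<le> 2 * d"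
  have "snd l * (x - px) \<le> (m + h / d) * (x - px)" using l' x by (intro mult_right_mono) auto
  also have "\<dots> = m * (x - px) + h / d * (x - px)" by (rule distrib_right)
  also have "h / d * (x - px) \<le> h / d * (2 * d)" using x assms by (intro mult_left_mono) auto
  also have "h / d * (2 * d) = 2 * h" using assms by simp
  finally show "height l x \<le> py + m * (x - px) + 3 * h"
    using l' by (simp add: height_shift[of l x px])
qed

lemma window_right:
  assumes l: "l \<in> window qx qy (m - h / d) (h / d) h" and q: "qy = py + m * (qx - px)" "px \<le> qx"
    and "0 < d" "0 \<le> h"
  shows "py \<le> height l px" "qy \<le> height l qx"
    and "x \<le> qx \<Longrightarrow> qx - x \<le> 2 * d \<Longrightarrow> height l x \<le> py + m * (x - px) + 3 * h"
proof -
  have l': "m - h / d \<le> snd l" "snd l \<le> m" "qy \<le> height l qx" "height l qx \<le> qy + h"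
    using l by (auto simp: window_def)
  show "qy \<le> height l qx" by fact
  have "snd l * (qx - px) \<le> m * (qx - px)" using l' q by (intro mult_right_mono) auto
  then show "py \<le> height l px" using l' q by (simp add: height_shift[of l qx px])
  assume x: "x \<le> qx" "qx - x \<le> 2 * d"
  have "(m - h / d) * (qx - x) \<le> snd l * (qx - x)" using l' x by (intro mult_right_mono) auto
  moreover have "(m - h / d) * (qx - x) = m * (qx - x) - h / d * (qx - x)" by (rule left_diff_distrib)
  moreover have "h / d * (qx - x) \<le> h / d * (2 * d)" using x assms by (intro mult_left_mono) auto
  moreover have "h / d * (2 * d) = 2 * h" using assms by simp
  ultimately have "height l x \<le> qy + h - m * (qx - x) + 2 * h"
    using l' unfolding height_shift[of l qx x] by linarith
  then show "height l x \<le> py + m * (x - px) + 3 * h" by (simp add: q algebra_simps)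
qed

text \<open>Let \<open>i\<close> be the lowest level at which a guide is present. It keeps the envelope within
  \<open>3 * sqrt (i * d)\<close> of the segment \<open>pq\<close> on the piece, so the envelope has relative slope at most \<open>3 * sqrt (i / d)\<close> there, and at least \<open>i - 1\<close>
  levels are missed. If all levels are missed, there are so many that the trivial
  slope bound 3 is good enough. Either way the cost is linear in the number of missed levels.\<close>

lemma inner_piece_slope:
  fixes p q :: "real \<times> real"
  defines "X \<equiv> fst q - fst p" and "m \<equiv> (snd q - snd p) / (fst q - fst p)"
  defines "w \<equiv> X / real (pieces X)"
  assumes X: "X > 0" and j: "j \<in> inner_pieces X" and F: "finite F"
    and steep: "\<And>l. l \<in> F \<Longrightarrow> \<bar>snd l - m\<bar> \<le> 3"
  defines "E \<equiv> {l \<in> F. snd p \<le> height l (fst p) \<and> snd q \<le> height l (fst q)}"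
  shows "\<exists>s. w * s^2 / 2 \<le> 9 / (2 * real (end_gap X j)) * (1 + real (card (missed_levels F p q j))) \<and>
    (\<forall>x l. fst p + real j * w \<le> x \<and> x \<le> fst p + real (Suc j) * w \<and> l \<in> E \<and> height l x = envelope E x
       \<longrightarrow> \<bar>snd l - m\<bar> \<le> s)"
proof -
  define g where "g = end_gap X j"
  define d where "d = end_dist X j"
  define I where "I = nat \<lfloor>d\<rfloor>"
  define A where "A = missed_levels F p q j"
  have A: "A = {i \<in> {1..I}. F \<inter> guides p q j i = {}}"
    unfolding A_def missed_levels_def I_def d_def X_def ..
  have w: "w > 0" using X pieces_pos by (simp add: w_def)
  have j2: "2 \<le> j" "j < pieces X - 2" using j by (auto simp: inner_pieces_def)
  have g: "2 \<le> g" using j2 by (auto simp: g_def end_gap_def)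
  have d: "d = real g * w" unfolding d_def g_def end_dist_def w_def ..
  have dpos: "d > 0" using d g w by simp
  have Xw: "X = real (pieces X) * w" using X pieces_pos[OF X] by (simp add: w_def)
  have qm: "snd q = snd p + m * (fst q - fst p)" using X by (simp add: m_def X_def)
  show ?thesis
  proof (cases "A = {1..I}")
    case True
    have "w * 3^2 / 2 \<le> 9 / (2 * real g) * (1 + real (card A))"
    proof -
      have "d \<le> 1 + real (card A)" unfolding True I_def by simp linarith
      then have "9 / (2 * real g) * d \<le> 9 / (2 * real g) * (1 + real (card A))"
        by (intro mult_left_mono) auto
      then show ?thesis using g by (simp add: d)
    qed
    then show ?thesis using steep unfolding g_def A_def E_def by blast
  next
    case False
    then have ex: "\<exists>i. i \<in> {1..I} \<and> F \<inter> guides p q j i \<noteq> {}" by (auto simp: A)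
    define i where "i = (LEAST i. i \<in> {1..I} \<and> F \<inter> guides p q j i \<noteq> {})"
    have i: "i \<in> {1..I}" "F \<inter> guides p q j i \<noteq> {}" using LeastI_ex[OF ex] by (auto simp: i_def)
    have "i' \<in> A" if "i' \<in> {1..<i}" for i'
    proof -
      have "\<not> (i' \<in> {1..I} \<and> F \<inter> guides p q j i' \<noteq> {})"
        using not_less_Least[of i' "\<lambda>i. i \<in> {1..I} \<and> F \<inter> guides p q j i \<noteq> {}"] that
        by (simp add: i_def)
      then show ?thesis using that i by (simp add: A)
    qed
    then have "{1..<i} \<subseteq> A" by blast
    then have "card {1..<i} \<le> card A" by (intro card_mono) (simp_all add: A)
    then have iA: "real i \<le> 1 + real (card A)" by simp
    define h where "h = sqrt (real i * d)"
    have h: "0 \<le> h" "h^2 = real i * d" using dpos by (auto simp: h_def)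
    obtain l0 where l0: "l0 \<in> F" "l0 \<in> guides p q j i" using i(2) by blast
    have low: "l0 \<in> E \<and> (\<forall>x. fst p + real j * w \<le> x \<and> x \<le> fst p + real (Suc j) * w
        \<longrightarrow> height l0 x \<le> snd p + m * (x - fst p) + 3 * h)"
    proof (cases "j \<le> pieces X - 1 - j")
      case True
      have "l0 \<in> window (fst p) (snd p) m (h / d) h"
        using l0(2) True unfolding guides_def Let_def X_def m_def h_def d_def by simp
      note lw = window_left[OF this qm _ dpos h(1)]
      have "g = j" using True by (simp add: g_def end_gap_def)
      show ?thesis
      proof (intro conjI allI impI)
        show "l0 \<in> E" using lw l0(1) X by (auto simp: E_def X_def)
        fix x assume x: "fst p + real j * w \<le> x \<and> x \<le> fst p + real (Suc j) * w"
        have "w \<le> real j * w" using j2 w by simp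
        moreover have "0 \<le> real j * w" using w by simp
        ultimately have "fst p \<le> x" "x - fst p \<le> 2 * d"
          using x unfolding d \<open>g = j\<close> by (auto simp: distrib_right)
        then show "height l0 x \<le> snd p + m * (x - fst p) + 3 * h" using lw(3) X by (auto simp: X_def)
      qed
    next
      case False
      have "l0 \<in> window (fst q) (snd q) (m - h / d) (h / d) h"
        using l0(2) False unfolding guides_def Let_def X_def m_def h_def d_def by simp
      note lw = window_right[OF this qm _ dpos h(1)]
      have g': "g = pieces X - 1 - j" using False by (simp add: g_def end_gap_def)
      have gj: "real (pieces X) = real g + 1 + real j" unfolding g' using j2 by simp
      show ?thesis
      proof (intro conjI allI impI)
        show "l0 \<in> E" using lw l0(1) X by (auto simp: E_def X_def)
        fix x assume x: "fst p + real j * w \<le> x \<and> x \<le> fst p + real (Suc j) * w"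
        have "w \<le> real g * w" using g w by simp
        moreover have "X = real g * w + w + real j * w"
          using Xw unfolding gj by (simp add: algebra_simps)
        then have "fst q = fst p + real g * w + w + real j * w" unfolding X_def by linarith
        moreover have "0 \<le> real g * w" using w by simp
        moreover have "real (Suc j) * w = w + real j * w" by (simp add: distrib_right)
        ultimately have "x \<le> fst q" "fst q - x \<le> 2 * d"
          using x unfolding d by linarith+
        then show "height l0 x \<le> snd p + m * (x - fst p) + 3 * h" using lw(3) X by (auto simp: X_def)
      qed
    qed
    have "\<bar>snd l - m\<bar> \<le> 3 * h / d"
      if x: "fst p + real j * w \<le> x" "x \<le> fst p + real (Suc j) * w"
        and l: "l \<in> E" "height l x = envelope E x" for x l
    proof (rule active_slope_le[OF _ _ _ qm])
      show "finite E" using F by (simp add: E_def)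
      show "l0 \<in> E" "height l0 x \<le> snd p + m * (x - fst p) + 3 * h" using low x by auto
      show "0 < d" by fact
      have "g \<le> j" by (simp add: g_def end_gap_def)
      then have "real g * w \<le> real j * w" using w by simp
      then show "d \<le> x - fst p" using x unfolding d by linarith
      have "real (Suc j + g) \<le> real (pieces X)"
        using j2 by (simp only: of_nat_le_iff) (auto simp: g_def end_gap_def)
      then have "real (Suc j + g) * w \<le> real (pieces X) * w" using w by (intro mult_right_mono) auto
      then have "real (Suc j + g) * w \<le> X" using Xw by linarith
      then have "real (Suc j) * w + real g * w \<le> fst q - fst p"
        unfolding X_def by (simp add: distrib_right)
      then show "d \<le> fst q - x" using x unfolding d by linarith
    qed (use l in \<open>auto simp: E_def\<close>)
    moreover have "w * (3 * h / d)^2 / 2 \<le> 9 / (2 * real g) * (1 + real (card A))"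
    proof -
      have "(3 * h / d)^2 = 9 * h^2 / d^2" by (simp add: power_divide power_mult_distrib)
      also have "\<dots> = 9 * real i / d" using dpos unfolding h(2) by (simp add: power2_eq_square)
      finally have "(3 * h / d)^2 = 9 * real i / d" .
      then have "w * (3 * h / d)^2 / 2 = 9 / (2 * real g) * real i"
        using w g by (simp add: d)
      also have "\<dots> \<le> 9 / (2 * real g) * (1 + real (card A))"
        using iA by (intro mult_left_mono) auto
      finally show ?thesis .
    qed
    ultimately show ?thesis unfolding g_def A_def by blast
  qed
qed

context square_frame
begin

text \<open>Climb from \<open>p\<close> to the lower envelope of all lines above \<open>p\<close> and \<open>q\<close>, follow it, and descend to
  \<open>q\<close>. The lines \<open>l1\<close> and \<open>l2\<close> lie above both points because their slopes 2 and -2 exceed that of \<open>pq\<close> in absolute value, so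
  the envelope starts and ends at height at most \<open>k\<close>. The climbs cost \<open>k\<close> each, the difference of the two
  heights enters the linear term with another \<open>k\<close>, and the four outer pieces cost \<open>9 / 2\<close> each.\<close>

lemma reaches_pair:
  fixes p q :: "real \<times> real"
  defines "X \<equiv> fst q - fst p" and "m \<equiv> (snd q - snd p) / (fst q - fst p)"
  assumes bnd: "0 \<le> fst p" "fst p < fst q" "fst q \<le> L" "\<bar>snd q - snd p\<bar> \<le> fst q - fst p"
    and F: "finite F" "track ` F \<subseteq> G" "\<And>l. l \<in> F \<Longrightarrow> \<bar>snd l\<bar> \<le> 2"
    and up: "l1 \<in> F" "snd l1 = 2" "snd p \<le> height l1 (fst p)" "height l1 (fst p) \<le> snd p + k"
    and down: "l2 \<in> F" "snd l2 = -2" "snd q \<le> height l2 (fst q)" "height l2 (fst q) \<le> snd q + k"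
    and risers: "(pt (fst p) (snd p), pt (fst p) (snd p + k)) \<in> G"
      "(pt (fst q) (snd q), pt (fst q) (snd q + k)) \<in> G"
  shows "reaches G (pt (fst p) (snd p)) (pt (fst q) (snd q))
    (dist (pt (fst p) (snd p)) (pt (fst q) (snd q)) + 3 * k + 18 + detour F p q)"
proof -
  define E where "E = {l \<in> F. snd p \<le> height l (fst p) \<and> snd q \<le> height l (fst q)}"
  define w where "w = X / real (pieces X)"
  define f where "f = envelope E"
  define cm where "cm = sqrt (1 + m^2)"
  define V where "V x = x * cm + m / cm * (f x - m * x)" for x
  define t where "t j = fst p + real j * w" for j :: nat
  \<comment> \<open>The four outer pieces get the trivial bound \<open>3\<^sup>2 / 2\<close>: lines and \<open>pq\<close> have slopes at most 2 and 1.\<close>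
  define cost where "cost j = (if j \<in> inner_pieces X
     then 9 / (2 * real (end_gap X j)) * (1 + real (card (missed_levels F p q j))) else 9 / 2)" for j
  define N where "N = pieces X"
  have X: "X > 0" using bnd by (simp add: X_def)
  have N: "N > 0" using pieces_pos[OF X] by (simp add: N_def)
  have w: "w > 0" "w \<le> 1" using X N pieces_ge[of X] by (auto simp: w_def N_def)
  have Xw: "X = real N * w" using X N by (simp add: w_def N_def)
  have qm: "snd q = snd p + m * X" using X by (simp add: m_def X_def)
  have m: "\<bar>m\<bar> \<le> 1" using bnd by (simp add: m_def)
  have steep: "\<bar>snd l - m\<bar> \<le> 3" if "l \<in> F" for l using F(3)[OF that] m by linarith
  have finE: "finite E" using F(1) by (simp add: E_def)
  have trackE: "track ` E \<subseteq> G" using F(2) by (auto simp: E_def)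
  have "m * X \<le> 2 * X" "- 2 * X \<le> m * X"
    using m X mult_right_mono[of m 2 X] mult_right_mono[of "- 2" m X] by auto
  then have "snd q \<le> height l1 (fst q)" "snd p \<le> height l2 (fst p)"
    using up down qm height_shift[of l1 "fst q" "fst p"] height_shift[of l2 "fst q" "fst p"]
    by (auto simp: X_def)
  then have lE: "l1 \<in> E" "l2 \<in> E" using up down by (auto simp: E_def)
  then have neE: "E \<noteq> {}" by blast
  have fp: "snd p \<le> f (fst p)" "f (fst p) \<le> snd p + k"
    using envelope_attained[OF finE neE, of "fst p"] envelope_le[OF finE lE(1), of "fst p"] up
    by (auto simp: f_def E_def)
  have fq: "snd q \<le> f (fst q)" "f (fst q) \<le> snd q + k"
    using envelope_attained[OF finE neE, of "fst q"] envelope_le[OF finE lE(2), of "fst q"] down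
    by (auto simp: f_def E_def)
  have step: "reaches G (pt (t j) (f (t j))) (pt (t (Suc j)) (f (t (Suc j))))
      (V (t (Suc j)) - V (t j) + cost j)" if j: "j < N" for j
  proof -
    have "\<exists>s. w * s^2 / 2 \<le> cost j \<and>
      (\<forall>x l. t j \<le> x \<and> x \<le> t (Suc j) \<and> l \<in> E \<and> height l x = envelope E x \<longrightarrow> \<bar>snd l - m\<bar> \<le> s)"
    proof (cases "j \<in> inner_pieces X")
      case True
      then show ?thesis
        using inner_piece_slope[of q p j F] X F(1) steep
        unfolding cost_def t_def w_def E_def X_def m_def by simp
    next
      case False
      then have "w * 3^2 / 2 \<le> cost j" using w by (simp add: cost_def)
      then show ?thesis using steep unfolding E_def by blast
    qed
    then obtain s where s: "w * s^2 / 2 \<le> cost j"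
      "\<And>x l. t j \<le> x \<Longrightarrow> x \<le> t (Suc j) \<Longrightarrow> l \<in> E \<Longrightarrow> height l x = envelope E x \<Longrightarrow> \<bar>snd l - m\<bar> \<le> s"
      by blast
    have "real (Suc j) * w \<le> X" using j w unfolding Xw by (intro mult_right_mono) auto
    then have "t (Suc j) \<le> L" using bnd by (simp add: t_def X_def)
    moreover have "0 \<le> t j" using bnd w by (simp add: t_def)
    moreover have tt: "t (Suc j) - t j = w" by (simp add: t_def algebra_simps)
    ultimately have "reaches G (pt (t j) (f (t j))) (pt (t (Suc j)) (f (t (Suc j))))
      (t (Suc j) * cm + m / cm * (f (t (Suc j)) - m * t (Suc j)) + t (Suc j) * s^2 / 2 -
       (t j * cm + m / cm * (f (t j) - m * t j) + t j * s^2 / 2))"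
      unfolding f_def cm_def using w s(2)
      by (intro reaches_along_envelope[OF finE neE trackE]) auto
    moreover have "t (Suc j) * s^2 / 2 - t j * s^2 / 2 \<le> cost j"
      using s(1) unfolding tt[symmetric] by (simp add: algebra_simps)
    ultimately show ?thesis unfolding V_def by (elim reaches_mono) auto
  qed
  have chain: "reaches G (pt (t 0) (f (t 0))) (pt (t j) (f (t j))) (V (t j) - V (t 0) + (\<Sum>i<j. cost i))"
    if "j \<le> N" for j using that
  proof (induction j)
    case (Suc j)
    then have "reaches G (pt (t 0) (f (t 0))) (pt (t (Suc j)) (f (t (Suc j))))
      ((V (t j) - V (t 0) + (\<Sum>i<j. cost i)) + (V (t (Suc j)) - V (t j) + cost j))"
      by (intro reaches_trans[OF Suc.IH step]) auto
    then show ?case by (simp add: algebra_simps)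
  qed (simp add: reaches_refl)
  have "t 0 = fst p" "t N = fst q" using Xw unfolding t_def X_def by auto
  then have mid: "reaches G (pt (fst p) (f (fst p))) (pt (fst q) (f (fst q)))
      (V (fst q) - V (fst p) + (\<Sum>i<N. cost i))"
    using chain[of N] by simp
  have inner: "inner_pieces X \<subseteq> {..<N}" "{..<N} - inner_pieces X \<subseteq> {0, 1, N - 2, N - 1}"
    unfolding inner_pieces_def N_def by auto
  have "(\<Sum>i<N. cost i) = (\<Sum>i\<in>inner_pieces X. cost i) + (\<Sum>i\<in>{..<N} - inner_pieces X. cost i)"
    using inner(1) by (subst sum.subset_diff[of "inner_pieces X"]) auto
  also have "(\<Sum>i\<in>inner_pieces X. cost i) = detour F p q"
    unfolding detour_def cost_def X_def by (intro sum.cong) auto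
  also have "(\<Sum>i\<in>{..<N} - inner_pieces X. cost i) \<le> 18"
  proof -
    have "(\<Sum>i\<in>{..<N} - inner_pieces X. cost i) = real (card ({..<N} - inner_pieces X)) * (9 / 2)"
      by (simp add: cost_def)
    moreover have "card ({..<N} - inner_pieces X) \<le> card {0, 1, N - 2, N - 1}"
      using inner(2) by (intro card_mono) auto
    moreover have "card {0, 1, N - 2, N - 1} \<le> 4" by (intro order_trans[OF card_insert_le_m1]) auto
    ultimately show ?thesis by simp
  qed
  finally have costs: "(\<Sum>i<N. cost i) \<le> detour F p q + 18" by simp
  have cm: "cm > 0" "\<bar>m / cm\<bar> \<le> 1"
  proof -
    show "cm > 0" by (simp add: cm_def add_pos_nonneg)
    have "sqrt (m^2) \<le> cm" unfolding cm_def by (intro real_sqrt_le_mono) simp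
    then show "\<bar>m / cm\<bar> \<le> 1" using \<open>cm > 0\<close> by (simp add: abs_divide)
  qed
  have dist: "dist (pt (fst p) (snd p)) (pt (fst q) (snd q)) = X * cm"
  proof -
    have "(fst p - fst q)^2 + (snd p - snd q)^2 = X^2 * (1 + m^2)"
      unfolding qm by (simp add: X_def power2_eq_square algebra_simps)
    then show ?thesis using X unfolding dist_pt cm_def by (simp add: real_sqrt_mult)
  qed
  have "V (fst q) - V (fst p) = X * cm + m / cm * ((f (fst q) - snd q) - (f (fst p) - snd p))"
    unfolding V_def qm X_def by (simp add: algebra_simps add_divide_distrib diff_divide_distrib)
  also have "m / cm * ((f (fst q) - snd q) - (f (fst p) - snd p)) \<le> 1 * k"
  proof -
    have "m / cm * ((f (fst q) - snd q) - (f (fst p) - snd p))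
      \<le> \<bar>m / cm\<bar> * \<bar>(f (fst q) - snd q) - (f (fst p) - snd p)\<bar>"
      by (metis abs_ge_self abs_mult)
    also have "\<dots> \<le> 1 * k" using cm fp fq by (intro mult_mono) auto
    finally show ?thesis .
  qed
  finally have VV: "V (fst q) - V (fst p) \<le> X * cm + k" by simp
  have "reaches G (pt (fst p) (snd p)) (pt (fst p) (f (fst p))) k"
    using fp by (intro reaches_segment[OF risers(1)] pt_on_riser) (auto simp: dist_pt)
  moreover have "reaches G (pt (fst q) (f (fst q))) (pt (fst q) (snd q)) k"
    using fq by (intro reaches_segment[OF risers(2)] pt_on_riser) (auto simp: dist_pt)
  ultimately have "reaches G (pt (fst p) (snd p)) (pt (fst q) (snd q))
      (k + ((V (fst q) - V (fst p) + (\<Sum>i<N. cost i)) + k))"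
    using mid reaches_trans by blast
  then show ?thesis unfolding dist using VV costs by (elim reaches_mono) auto
qed

end

section \<open>Few lines that serve most pairs\<close>

text \<open>A set of density at least \<open>\<mu>\<close> is missed by at most a fraction \<open>1 - \<mu>\<close> of all \<open>z\<close>; some \<open>z\<close> is as good as the
  average.\<close>

lemma average_miss:
  fixes w \<mu> :: "'t \<Rightarrow> real" and R :: "'t \<Rightarrow> 'l set"
  assumes fin: "finite T" "finite \<Omega>" "\<Omega> \<noteq> {}"
    and w: "\<And>t. t \<in> T \<Longrightarrow> 0 \<le> w t"
    and R: "\<And>t. t \<in> T \<Longrightarrow> R t \<subseteq> \<Omega>" "\<And>t. t \<in> T \<Longrightarrow> \<mu> t * real (card \<Omega>) \<le> real (card (R t))"
  shows "\<exists>z\<in>\<Omega>. (\<Sum>t\<in>T. if z \<in> R t then 0 else w t) \<le> (\<Sum>t\<in>T. w t * (1 - \<mu> t))"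
proof (rule ccontr)
  assume "\<not> ?thesis"
  then have "(\<Sum>z\<in>\<Omega>. \<Sum>t\<in>T. w t * (1 - \<mu> t)) < (\<Sum>z\<in>\<Omega>. \<Sum>t\<in>T. if z \<in> R t then 0 else w t)"
    by (intro sum_strict_mono[OF fin(2,3)]) (simp add: not_le)
  also have "\<dots> = (\<Sum>t\<in>T. \<Sum>z\<in>\<Omega>. if z \<in> R t then 0 else w t)" by (rule sum.swap)
  also have "\<dots> = (\<Sum>t\<in>T. (real (card \<Omega>) - real (card (R t))) * w t)"
  proof (rule sum.cong)
    fix t assume t: "t \<in> T"
    have "(\<Sum>z\<in>\<Omega>. if z \<in> R t then 0 else w t) = (\<Sum>z\<in>\<Omega> - R t. w t)"
      using fin by (intro sum.mono_neutral_cong_right) auto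
    also have "\<dots> = real (card (\<Omega> - R t)) * w t" by simp
    also have "real (card (\<Omega> - R t)) = real (card \<Omega>) - real (card (R t))"
      using R(1)[OF t] fin by (simp add: card_Diff_subset finite_subset card_mono of_nat_diff)
    finally show "(\<Sum>z\<in>\<Omega>. if z \<in> R t then 0 else w t)
      = (real (card \<Omega>) - real (card (R t))) * w t" .
  qed simp
  also have "\<dots> \<le> (\<Sum>t\<in>T. (real (card \<Omega>) * (1 - \<mu> t)) * w t)"
    using R(2) w by (intro sum_mono mult_right_mono) (auto simp: algebra_simps)
  also have "\<dots> = (\<Sum>z\<in>\<Omega>. \<Sum>t\<in>T. w t * (1 - \<mu> t))"
    by (simp add: sum_distrib_left mult_ac)
  finally show False by simp
qed

text \<open>A derandomised form of choosing \<open>N\<close> independent uniform points: each further point multiplies the expected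
  weight of the missed sets by the factor \<open>1 - \<mu>\<close>. The factors still to come are built into the
  weights, so that the points can be picked one by one.\<close>

lemma few_points_hit_most:
  fixes w \<mu> :: "'t \<Rightarrow> real" and R :: "'t \<Rightarrow> 'l set"
  assumes fin: "finite T" "finite \<Omega>" "\<Omega> \<noteq> {}"
    and w: "\<And>t. t \<in> T \<Longrightarrow> 0 \<le> w t" and \<mu>: "\<And>t. t \<in> T \<Longrightarrow> \<mu> t \<le> 1"
    and R: "\<And>t. t \<in> T \<Longrightarrow> R t \<subseteq> \<Omega>" "\<And>t. t \<in> T \<Longrightarrow> \<mu> t * real (card \<Omega>) \<le> real (card (R t))"
  shows "\<exists>Z. Z \<subseteq> \<Omega> \<and> card Z \<le> N \<and>
    (\<Sum>t\<in>T. if Z \<inter> R t = {} then w t else 0) \<le> (\<Sum>t\<in>T. w t * (1 - \<mu> t) ^ N)"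
  using w
proof (induction N arbitrary: w)
  case 0
  then show ?case by (intro exI[of _ "{}"]) simp
next
  case (Suc N)
  obtain Z where Z: "Z \<subseteq> \<Omega>" "card Z \<le> N"
    "(\<Sum>t\<in>T. if Z \<inter> R t = {} then w t * (1 - \<mu> t) else 0) \<le> (\<Sum>t\<in>T. w t * (1 - \<mu> t) * (1 - \<mu> t) ^ N)"
    using Suc.IH[of "\<lambda>t. w t * (1 - \<mu> t)"] Suc.prems \<mu> by auto
  have "\<exists>z\<in>\<Omega>. (\<Sum>t\<in>T. if z \<in> R t then 0 else if Z \<inter> R t = {} then w t else 0)
       \<le> (\<Sum>t\<in>T. (if Z \<inter> R t = {} then w t else 0) * (1 - \<mu> t))"
    using Suc.prems by (intro average_miss[OF fin _ R]) auto
  then obtain z where z: "z \<in> \<Omega>"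
    "(\<Sum>t\<in>T. if z \<in> R t then 0 else if Z \<inter> R t = {} then w t else 0)
       \<le> (\<Sum>t\<in>T. (if Z \<inter> R t = {} then w t else 0) * (1 - \<mu> t))"
    by blast
  have "(\<Sum>t\<in>T. if insert z Z \<inter> R t = {} then w t else 0)
    = (\<Sum>t\<in>T. if z \<in> R t then 0 else if Z \<inter> R t = {} then w t else 0)"
    by (intro sum.cong) auto
  also note z(2)
  also have "(\<Sum>t\<in>T. (if Z \<inter> R t = {} then w t else 0) * (1 - \<mu> t))
    = (\<Sum>t\<in>T. if Z \<inter> R t = {} then w t * (1 - \<mu> t) else 0)"
    by (intro sum.cong) auto
  also note Z(3)
  also have "(\<Sum>t\<in>T. w t * (1 - \<mu> t) * (1 - \<mu> t) ^ N) = (\<Sum>t\<in>T. w t * (1 - \<mu> t) ^ Suc N)"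
    by (simp add: mult_ac)
  finally show ?case
    using Z(1,2) z(1) card_insert_le_m1[of "Suc N" Z z] by (intro exI[of _ "insert z Z"]) auto
qed

text \<open>A finite stand-in for the uniform distribution on lines of slope at most 2 and bounded intercept:
  both parameters are multiples of \<open>1 / D\<close>.\<close>

definition mesh :: "nat \<Rightarrow> int \<Rightarrow> (real \<times> real) set" where
  "mesh D B = (\<lambda>(i, j). (of_int j / real D, of_int i / real D)) ` ({- 2 * int D..2 * int D} \<times> {- B..B})"

lemma card_int_between:
  fixes \<alpha> \<beta> :: real shows "\<beta> - \<alpha> - 1 \<le> real (card {\<lceil>\<alpha>\<rceil>..\<lfloor>\<beta>\<rfloor>})"
proof -
  have "real (card {\<lceil>\<alpha>\<rceil>..\<lfloor>\<beta>\<rfloor>}) \<ge> real_of_int (\<lfloor>\<beta>\<rfloor> - \<lceil>\<alpha>\<rceil> + 1)" by simp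
  then show ?thesis by linarith
qed

lemma inj_mesh_map: "D > 0 \<Longrightarrow> inj_on (\<lambda>(i, j). (of_int j / real D, of_int i / real D)) A"
  by (auto simp: inj_on_def)

lemma finite_mesh: "finite (mesh D B)"
  by (simp add: mesh_def)

text \<open>A window is a parallelogram of area \<open>w * h\<close>. Counting column by column over the slope, the mesh fills at
  least half of the expected number in each direction once the mesh size is at most half the width.\<close>

lemma card_window_mesh:
  fixes L :: real
  assumes D: "D > 0" and x: "0 \<le> x" "x \<le> L" and y: "0 \<le> y" "y \<le> L" and h: "h \<le> L"
    and b: "- 2 \<le> b" "b + w \<le> 2" and fine: "2 \<le> real D * w" "2 \<le> real D * h"
  shows "real D^2 * (w * h) / 4 \<le> real (card (mesh D \<lceil>4 * L * real D\<rceil> \<inter> window x y b w h))"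
proof -
  define A where "A = {\<lceil>real D * b\<rceil>..\<lfloor>real D * (b + w)\<rfloor>}"
  define C where "C i = {\<lceil>real D * y - of_int i * x\<rceil>..\<lfloor>real D * (y + h) - of_int i * x\<rfloor>}" for i :: int
  define g where "g = (\<lambda>(i :: int, j :: int). (of_int j / real D, of_int i / real D))"
  have D': "real D > 0" using D by simp
  have A: "real D * w / 2 \<le> real (card A)"
    using card_int_between[of "real D * (b + w)" "real D * b"] fine unfolding A_def
    by (simp add: distrib_left)
  have C: "real D * h / 2 \<le> real (card (C i))" for i
    using card_int_between[of "real D * (y + h) - of_int i * x" "real D * y - of_int i * x"] fine
    unfolding C_def by (simp add: distrib_left)
  have "g ` (SIGMA i:A. C i) \<subseteq> mesh D \<lceil>4 * L * real D\<rceil> \<inter> window x y b w h"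
  proof
    fix l assume "l \<in> g ` (SIGMA i:A. C i)"
    then obtain i j where ij: "i \<in> A" "j \<in> C i" "l = (of_int j / real D, of_int i / real D)"
      by (auto simp: g_def)
    have i: "real D * b \<le> of_int i" "of_int i \<le> real D * (b + w)"
      using ij(1) unfolding A_def by (simp_all add: ceiling_le_iff le_floor_iff)
    have j: "real D * y \<le> of_int j + of_int i * x" "of_int j + of_int i * x \<le> real D * (y + h)"
      using ij(2) unfolding C_def by (simp_all add: ceiling_le_iff le_floor_iff algebra_simps)
    have "real D * (- 2) \<le> real D * b" "real D * (b + w) \<le> real D * 2"
      using b D' mult_left_mono[of "- 2" b "real D"] mult_left_mono[of "b + w" 2 "real D"] by auto
    then have i2: "- 2 * real D \<le> of_int i" "of_int i \<le> 2 * real D" using i by linarith+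
    then have "- 2 * int D \<le> i" "i \<le> 2 * int D" by linarith+
    moreover have "\<bar>real_of_int j\<bar> \<le> 4 * L * real D"
    proof -
      have "\<bar>real_of_int i * x\<bar> \<le> 2 * real D * L"
        unfolding abs_mult using i2 x by (intro mult_mono) auto
      moreover have "0 \<le> real D * y" "real D * (y + h) \<le> real D * (L + L)"
        using y h D' by (auto intro!: mult_left_mono)
      ultimately show ?thesis using j D' x by (simp add: abs_le_iff algebra_simps)
    qed
    then have "- \<lceil>4 * L * real D\<rceil> \<le> j" "j \<le> \<lceil>4 * L * real D\<rceil>" by linarith+
    ultimately have "l \<in> mesh D \<lceil>4 * L * real D\<rceil>" using ij(3) by (auto simp: mesh_def)
    moreover have "l \<in> window x y b w h"
      using i j D' unfolding window_def height_def ij(3)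
      by (auto simp: field_simps)
    ultimately show "l \<in> mesh D \<lceil>4 * L * real D\<rceil> \<inter> window x y b w h" by blast
  qed
  then have "card (g ` (SIGMA i:A. C i)) \<le> card (mesh D \<lceil>4 * L * real D\<rceil> \<inter> window x y b w h)"
    using finite_mesh by (intro card_mono) auto
  moreover have "card (g ` (SIGMA i:A. C i)) = card (SIGMA i:A. C i)"
    unfolding g_def by (rule card_image[OF inj_mesh_map[OF D]])
  moreover have "real (card (SIGMA i:A. C i)) = (\<Sum>i\<in>A. real (card (C i)))"
    by (subst card_SigmaI) (auto simp: A_def C_def)
  moreover have "(real D * w / 2) * (real D * h / 2) \<le> (\<Sum>i\<in>A. real (card (C i)))"
  proof -
    have "(real D * w / 2) * (real D * h / 2) \<le> real (card A) * (real D * h / 2)"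
      using A fine by (intro mult_right_mono) auto
    also have "\<dots> = (\<Sum>i\<in>A. real D * h / 2)" by simp
    also have "\<dots> \<le> (\<Sum>i\<in>A. real (card (C i)))" by (intro sum_mono C)
    finally show ?thesis .
  qed
  ultimately show ?thesis by (simp add: power2_eq_square mult_ac)
qed

lemma card_mesh_le:
  fixes L :: real
  assumes "D \<ge> 2" "L \<ge> 1"
  shows "real (card (mesh D \<lceil>4 * L * real D\<rceil>)) \<le> 50 * L * real D^2"
proof -
  have LD: "L * real D \<ge> 1 * 2" using assms by (intro mult_mono) auto
  have "card (mesh D \<lceil>4 * L * real D\<rceil>)
    \<le> card ({- 2 * int D..2 * int D} \<times> {- \<lceil>4 * L * real D\<rceil>..\<lceil>4 * L * real D\<rceil>})"
    unfolding mesh_def by (intro card_image_le) auto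
  then have "real (card (mesh D \<lceil>4 * L * real D\<rceil>))
    \<le> real (card {- 2 * int D..2 * int D} * card {- \<lceil>4 * L * real D\<rceil>..\<lceil>4 * L * real D\<rceil>})"
    unfolding card_cartesian_product by (simp only: of_nat_le_iff)
  also have "\<dots> = real (card {- 2 * int D..2 * int D})
      * real (card {- \<lceil>4 * L * real D\<rceil>..\<lceil>4 * L * real D\<rceil>})" by simp
  also have "\<dots> \<le> (5 * real D) * (10 * (L * real D))"
  proof (rule mult_mono)
    show "real (card {- 2 * int D..2 * int D}) \<le> 5 * real D" using assms by simp
    have "real (card {- \<lceil>4 * L * real D\<rceil>..\<lceil>4 * L * real D\<rceil>}) = 2 * of_int \<lceil>4 * L * real D\<rceil> + 1"
      using LD by (simp add: of_nat_nat)
    then show "real (card {- \<lceil>4 * L * real D\<rceil>..\<lceil>4 * L * real D\<rceil>}) \<le> 10 * (L * real D)"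
      using LD by linarith
  qed auto
  finally show ?thesis by (simp add: power2_eq_square mult_ac)
qed

lemma end_dist_le: "X > 0 \<Longrightarrow> end_dist X j \<le> X"
proof -
  assume X: "X > 0"
  have "end_dist X j = real (end_gap X j) / real (pieces X) * X" by (simp add: end_dist_def)
  also have "\<dots> \<le> 1 * X"
    using X pieces_pos[OF X] by (intro mult_right_mono) (auto simp: end_gap_def)
  finally show ?thesis by simp
qed

text \<open>Level \<open>i\<close> guides have area \<open>i\<close> whatever the distance \<open>d\<close>, out of a total of order \<open>L\<close>.\<close>

lemma guides_dense:
  fixes L :: real and p q :: "real \<times> real"
  assumes L: "L \<ge> 1" and D: "real D \<ge> 2 * L"
    and p: "0 \<le> fst p" "fst p \<le> L" "0 \<le> snd p" "snd p \<le> L"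
    and q: "0 \<le> fst q" "fst q \<le> L" "0 \<le> snd q" "snd q \<le> L"
    and pq: "fst p < fst q" "\<bar>snd q - snd p\<bar> \<le> fst q - fst p"
    and i: "i \<in> {1..nat \<lfloor>end_dist (fst q - fst p) j\<rfloor>}"
  defines "\<Omega> \<equiv> mesh D \<lceil>4 * L * real D\<rceil>"
  shows "real i / (200 * L) * real (card \<Omega>) \<le> real (card (\<Omega> \<inter> guides p q j i))"
    and "real i / (200 * L) \<le> 1"
proof -
  define X m where "X = fst q - fst p" and "m = (snd q - snd p) / X"
  define d where "d = end_dist X j"
  define h where "h = sqrt (real i * d)"
  have X: "X > 0" "X \<le> L" using pq p q by (auto simp: X_def)
  have m: "- 1 \<le> m" "m \<le> 1" using pq X by (auto simp: m_def X_def field_simps)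
  have "d \<le> L" using end_dist_le[OF X(1), of j] X unfolding d_def by linarith
  have "1 \<le> i \<and> i \<le> nat \<lfloor>d\<rfloor>" using i unfolding d_def X_def by auto
  then have i1: "1 \<le> real i" "real i \<le> d" by linarith+
  then have d: "1 \<le> d" by simp
  have h2: "h^2 = real i * d" "h > 0" using i1 by (auto simp: h_def)
  have "h \<le> sqrt (d * d)" unfolding h_def using i1 by (intro real_sqrt_le_mono mult_right_mono) auto
  then have hd: "h \<le> d" using d by simp
  have "sqrt (1 * 1) \<le> h" unfolding h_def using i1 d by (intro real_sqrt_le_mono mult_mono) auto
  then have h1: "1 \<le> h" by simp
  have wh: "h / d * h = real i" using h2 d by (simp add: power2_eq_square field_simps)
  have w1: "h / d \<le> 1" using hd d by simp
  have "1 / L \<le> h / d" using h1 \<open>d \<le> L\<close> d by (intro frac_le) auto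
  then have "2 * L * (1 / L) \<le> real D * (h / d)" using D L by (intro mult_mono) auto
  then have fine: "2 \<le> real D * (h / d)" using L by simp
  have "2 * 1 \<le> real D * h" using D L h1 by (intro mult_mono) auto
  note fine = fine this
  have D2: "D \<ge> 2" using D L by linarith
  have "real D^2 * real i / 4 \<le> real (card (\<Omega> \<inter> guides p q j i))"
  proof (cases "j \<le> pieces X - 1 - j")
    case True
    have "guides p q j i = window (fst p) (snd p) m (h / d) h"
      using True unfolding guides_def Let_def X_def m_def h_def d_def by simp
    then show ?thesis
      using card_window_mesh[of D "fst p" L "snd p" h m "h / d"] fine D2 p m w1 hd \<open>d \<le> L\<close>
      unfolding \<Omega>_def wh by simp
  next
    case False
    have "guides p q j i = window (fst q) (snd q) (m - h / d) (h / d) h"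
      using False unfolding guides_def Let_def X_def m_def h_def d_def by simp
    then show ?thesis
      using card_window_mesh[of D "fst q" L "snd q" h "m - h / d" "h / d"] fine D2 q m w1 hd \<open>d \<le> L\<close>
      unfolding \<Omega>_def wh by simp
  qed
  moreover have "real i / (200 * L) * real (card \<Omega>) \<le> real i / (200 * L) * (50 * L * real D^2)"
    using card_mesh_le[OF D2 L] L unfolding \<Omega>_def by (intro mult_left_mono) auto
  moreover have "real i / (200 * L) * (50 * L * real D^2) = real D^2 * real i / 4"
    using L by simp
  ultimately show "real i / (200 * L) * real (card \<Omega>) \<le> real (card (\<Omega> \<inter> guides p q j i))" by linarith
  show "real i / (200 * L) \<le> 1" using i1 \<open>d \<le> L\<close> L by simp
qed

lemma sum_exp_le:
  assumes "a > 0" shows "(\<Sum>i\<in>{1..I}. exp (- real i / a)) \<le> a"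
proof -
  define r where "r = exp (- 1 / a)"
  have r: "0 < r" "r < 1" using assms by (auto simp: r_def)
  have "(1 - r) * (\<Sum>i\<in>{1..I}. r ^ i) = r - r ^ Suc I"
  proof (induction I)
    case (Suc I)
    have "(1 - r) * (\<Sum>i\<in>{1..Suc I}. r ^ i) = (1 - r) * (\<Sum>i\<in>{1..I}. r ^ i) + (1 - r) * r ^ Suc I"
      by (simp add: distrib_left)
    also have "\<dots> = (r - r ^ Suc I) + (1 - r) * r ^ Suc I" by (simp only: Suc)
    also have "\<dots> = r - r ^ Suc (Suc I)" by (simp add: left_diff_distrib)
    finally show ?case .
  qed simp
  then have "(1 - r) * (\<Sum>i\<in>{1..I}. r ^ i) \<le> r" using r by simp
  also have "r \<le> (1 - r) * a"
  proof -
    have "1 + 1 / a \<le> exp (1 / a)" by simp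
    then have "r * (1 + 1 / a) \<le> r * exp (1 / a)" using r by (intro mult_left_mono) auto
    also have "r * exp (1 / a) = 1" by (simp add: r_def exp_add[symmetric])
    finally show ?thesis using assms by (simp add: field_simps)
  qed
  finally have "(\<Sum>i\<in>{1..I}. r ^ i) \<le> a" using r by (simp add: mult_le_cancel_left)
  moreover have "exp (- real i / a) = r ^ i" for i by (simp add: r_def exp_of_nat_mult[symmetric])
  ultimately show ?thesis by simp
qed

text \<open>Summed over the pieces, the costs \<open>1 / end_gap\<close> form two harmonic series, one from each end; this
  is the origin of the logarithm.\<close>

lemma sum_inverse_end_gap_le:
  assumes "pieces X \<le> M"
  shows "(\<Sum>j\<in>inner_pieces X. 1 / real (end_gap X j)) \<le> 2 * harm M"
proof -
  let ?J = "pieces X"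
  have "(\<Sum>j\<in>inner_pieces X. 1 / real (end_gap X j))
    \<le> (\<Sum>j\<in>inner_pieces X. inverse (real j) + inverse (real (?J - 1 - j)))"
    by (intro sum_mono) (auto simp: end_gap_def min_def divide_inverse)
  also have "\<dots> = (\<Sum>j\<in>inner_pieces X. inverse (real j)) + (\<Sum>j\<in>inner_pieces X. inverse (real (?J - 1 - j)))"
    by (rule sum.distrib)
  also have "(\<Sum>j\<in>inner_pieces X. inverse (real j)) \<le> harm M"
    unfolding harm_def using assms by (intro sum_mono2) (auto simp: inner_pieces_def)
  also have "(\<Sum>j\<in>inner_pieces X. inverse (real (?J - 1 - j)))
    = (\<Sum>j\<in>(\<lambda>j. ?J - 1 - j) ` inner_pieces X. inverse (real j))"
    by (subst sum.reindex) (auto simp: inner_pieces_def inj_on_def)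
  also have "\<dots> \<le> harm M"
    unfolding harm_def using assms by (intro sum_mono2) (auto simp: inner_pieces_def)
  finally show ?thesis by simp
qed

text \<open>Adding lines never hurts the estimate, so the chosen lines may be completed by the grid.\<close>

lemma detour_antimono:
  assumes "F \<subseteq> F'" shows "detour F' p q \<le> detour F p q"
proof -
  have "card (missed_levels F' p q j) \<le> card (missed_levels F p q j)" for j
    using assms by (intro card_mono) (auto simp: missed_levels_def)
  then show ?thesis unfolding detour_def by (intro sum_mono mult_left_mono) auto
qed

text \<open>With about \<open>L / k\<close> lines, level \<open>i\<close> is missed with frequency at most \<open>(1 - i / (200 * L)) ^ N\<close>, hence at
  most \<open>exp (- i / (200 * k))\<close>. So the mean number of missed levels per piece is at most
  \<open>200 * k\<close>, independently of \<open>L\<close>.\<close>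

lemma few_lines_short_detours:
  fixes p q :: "'e \<Rightarrow> real \<times> real" and L k :: real
  assumes fin: "finite P" and L: "L \<ge> 1" "L \<le> real M" and k: "k > 0" "L / k \<le> real N"
    and p: "\<And>e. e \<in> P \<Longrightarrow> 0 \<le> fst (p e) \<and> fst (p e) \<le> L \<and> 0 \<le> snd (p e) \<and> snd (p e) \<le> L"
    and q: "\<And>e. e \<in> P \<Longrightarrow> 0 \<le> fst (q e) \<and> fst (q e) \<le> L \<and> 0 \<le> snd (q e) \<and> snd (q e) \<le> L"
    and pq: "\<And>e. e \<in> P \<Longrightarrow> fst (p e) < fst (q e) \<and> \<bar>snd (q e) - snd (p e)\<bar> \<le> fst (q e) - fst (p e)"
  shows "\<exists>Z. finite Z \<and> card Z \<le> N \<and> (\<forall>l\<in>Z. \<bar>snd l\<bar> \<le> 2) \<and>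
    (\<Sum>e\<in>P. detour Z (p e) (q e)) \<le> real (card P) * (9 * (1 + 200 * k) * harm M)"
proof -
  \<comment> \<open>Windows have slope range at least \<open>1 / L\<close>; this resolution puts two mesh steps into it.\<close>
  define D where "D = nat \<lceil>2 * L\<rceil>"
  have D: "real D \<ge> 2 * L" "D > 0" using L unfolding D_def by linarith+
  define \<Omega> where "\<Omega> = mesh D \<lceil>4 * L * real D\<rceil>"
  define X where "X e = fst (q e) - fst (p e)" for e
  define lev where "lev e j = {1..nat \<lfloor>end_dist (X e) j\<rfloor>}" for e j
  \<comment> \<open>The sets to be hit: one for each pair \<open>e\<close>, inner piece \<open>j\<close> and level \<open>i\<close>, weighted as in \<open>detour\<close>.\<close>
  define T where "T = (SIGMA e:P. SIGMA j:inner_pieces (X e). lev e j)"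
  define c where "c e j = 9 / (2 * real (end_gap (X e) j))" for e j
  define w where "w = (\<lambda>(e, j, i :: nat). c e j)"
  define \<mu> where "\<mu> = (\<lambda>(e :: 'e, j :: nat, i). real i / (200 * L))"
  define R where "R = (\<lambda>(e, j, i). \<Omega> \<inter> guides (p e) (q e) j i)"
  have finT: "finite T" unfolding T_def lev_def inner_pieces_def using fin by (intro finite_SigmaI) auto
  have dense: "\<mu> t * real (card \<Omega>) \<le> real (card (R t)) \<and> \<mu> t \<le> 1" if tT: "t \<in> T" for t
  proof -
    obtain e j i where t: "t = (e, j, i)" "e \<in> P" "i \<in> lev e j" using tT by (auto simp: T_def)
    show ?thesis
      using guides_dense[OF L(1) D(1), of "p e" "q e" i j] t p[OF t(2)] q[OF t(2)] pq[OF t(2)]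
      unfolding lev_def X_def \<mu>_def R_def \<Omega>_def by simp
  qed
  have c0: "c e j \<ge> 0" for e j by (simp add: c_def)
  have "0 \<le> 4 * L * real D" using L by simp
  then have "\<Omega> \<noteq> {}" unfolding \<Omega>_def mesh_def by auto
  then have "\<exists>Z. Z \<subseteq> \<Omega> \<and> card Z \<le> N \<and>
    (\<Sum>t\<in>T. if Z \<inter> R t = {} then w t else 0) \<le> (\<Sum>t\<in>T. w t * (1 - \<mu> t) ^ N)"
    using finT finite_mesh dense c0 by (intro few_points_hit_most) (auto simp: \<Omega>_def w_def R_def)
  then obtain Z where Z: "Z \<subseteq> \<Omega>" "card Z \<le> N"
    "(\<Sum>t\<in>T. if Z \<inter> R t = {} then w t else 0) \<le> (\<Sum>t\<in>T. w t * (1 - \<mu> t) ^ N)" by blast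
  have unroll: "(\<Sum>t\<in>T. g t) = (\<Sum>e\<in>P. \<Sum>j\<in>inner_pieces (X e). \<Sum>i\<in>lev e j. g (e, j, i))"
    for g :: "'e \<times> nat \<times> nat \<Rightarrow> real"
  proof -
    have "(\<Sum>t\<in>T. g t) = (\<Sum>e\<in>P. \<Sum>s\<in>(SIGMA j:inner_pieces (X e). lev e j). g (e, s))"
      unfolding T_def using fin by (subst sum.Sigma) (auto simp: inner_pieces_def lev_def intro!: finite_SigmaI)
    also have "\<dots> = (\<Sum>e\<in>P. \<Sum>j\<in>inner_pieces (X e). \<Sum>i\<in>lev e j. g (e, j, i))"
      by (intro sum.cong refl, subst sum.Sigma) (auto simp: inner_pieces_def lev_def)
    finally show ?thesis .
  qed
  have "(\<Sum>t\<in>T. if Z \<inter> R t = {} then w t else 0)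
    = (\<Sum>e\<in>P. \<Sum>j\<in>inner_pieces (X e). c e j * real (card (missed_levels Z (p e) (q e) j)))"
    unfolding unroll
  proof (intro sum.cong refl)
    fix e j
    have "Z \<inter> R (e, j, i) = Z \<inter> guides (p e) (q e) j i" for i using Z(1) by (auto simp: R_def)
    then have "(\<Sum>i\<in>lev e j. if Z \<inter> R (e, j, i) = {} then w (e, j, i) else 0)
      = (\<Sum>i\<in>missed_levels Z (p e) (q e) j. c e j)"
      unfolding missed_levels_def lev_def X_def w_def
      by (intro sum.mono_neutral_cong_right) auto
    then show "(\<Sum>i\<in>lev e j. if Z \<inter> R (e, j, i) = {} then w (e, j, i) else 0)
      = c e j * real (card (missed_levels Z (p e) (q e) j))" by simp
  qed
  moreover have "(\<Sum>t\<in>T. w t * (1 - \<mu> t) ^ N)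
    \<le> (\<Sum>e\<in>P. \<Sum>j\<in>inner_pieces (X e). c e j * (200 * k))"
    unfolding unroll
  proof (intro sum_mono)
    fix e j assume e: "e \<in> P" "j \<in> inner_pieces (X e)"
    have "(1 - \<mu> (e, j, i)) ^ N \<le> exp (- real i / (200 * k))" if "i \<in> lev e j" for i
    proof -
      have "\<mu> (e, j, i) \<le> 1" using dense[of "(e, j, i)"] e that by (auto simp: T_def)
      then have "(1 - \<mu> (e, j, i)) ^ N \<le> exp (- \<mu> (e, j, i)) ^ N"
        using exp_ge_add_one_self[of "- \<mu> (e, j, i)"] by (intro power_mono) auto
      also have "\<dots> = exp (- (\<mu> (e, j, i) * real N))" by (simp add: exp_of_nat_mult[symmetric] mult.commute)
      also have "\<dots> \<le> exp (- real i / (200 * k))"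
      proof -
        have "real i / (200 * L) * (L / k) \<le> \<mu> (e, j, i) * real N"
          using k L unfolding \<mu>_def prod.case by (intro mult_left_mono) auto
        moreover have "real i / (200 * L) * (L / k) = real i / (200 * k)" using L by simp
        ultimately show ?thesis by simp
      qed
      finally show ?thesis .
    qed
    then have "(\<Sum>i\<in>lev e j. w (e, j, i) * (1 - \<mu> (e, j, i)) ^ N)
      \<le> (\<Sum>i\<in>lev e j. c e j * exp (- real i / (200 * k)))"
      using c0 by (intro sum_mono) (auto simp: w_def intro!: mult_left_mono)
    also have "\<dots> = c e j * (\<Sum>i\<in>lev e j. exp (- real i / (200 * k)))" by (rule sum_distrib_left[symmetric])
    also have "\<dots> \<le> c e j * (200 * k)"
      using sum_exp_le[of "200 * k"] k c0 unfolding lev_def by (intro mult_left_mono) auto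
    finally show "(\<Sum>i\<in>lev e j. w (e, j, i) * (1 - \<mu> (e, j, i)) ^ N) \<le> c e j * (200 * k)" .
  qed
  ultimately have miss: "(\<Sum>e\<in>P. \<Sum>j\<in>inner_pieces (X e). c e j * real (card (missed_levels Z (p e) (q e) j)))
    \<le> (\<Sum>e\<in>P. \<Sum>j\<in>inner_pieces (X e). c e j * (200 * k))" using Z(3) by simp
  have "(\<Sum>e\<in>P. detour Z (p e) (q e)) = (\<Sum>e\<in>P. \<Sum>j\<in>inner_pieces (X e). c e j)
    + (\<Sum>e\<in>P. \<Sum>j\<in>inner_pieces (X e). c e j * real (card (missed_levels Z (p e) (q e) j)))"
    unfolding detour_def X_def[symmetric] c_def[symmetric] by (simp add: distrib_left sum.distrib)
  also have "\<dots> \<le> (\<Sum>e\<in>P. \<Sum>j\<in>inner_pieces (X e). c e j * (1 + 200 * k))"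
    using miss by (simp add: distrib_left sum.distrib)
  also have "\<dots> \<le> (\<Sum>e\<in>P. 9 * (1 + 200 * k) * harm M)"
  proof (rule sum_mono)
    fix e assume e: "e \<in> P"
    have "X e \<le> real M" using p[OF e] q[OF e] L by (auto simp: X_def)
    then have "pieces (X e) \<le> M" unfolding pieces_def by (simp add: nat_le_iff ceiling_le_iff)
    have "(\<Sum>j\<in>inner_pieces (X e). c e j * (1 + 200 * k))
      = 9 / 2 * (1 + 200 * k) * (\<Sum>j\<in>inner_pieces (X e). 1 / real (end_gap (X e) j))"
      unfolding c_def sum_distrib_left by (intro sum.cong) auto
    also have "\<dots> \<le> 9 / 2 * (1 + 200 * k) * (2 * harm M)"
      using sum_inverse_end_gap_le[OF \<open>pieces (X e) \<le> M\<close>] k by (intro mult_left_mono) auto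
    finally show "(\<Sum>j\<in>inner_pieces (X e). c e j * (1 + 200 * k)) \<le> 9 * (1 + 200 * k) * harm M"
      by simp
  qed
  also have "\<dots> = real (card P) * (9 * (1 + 200 * k) * harm M)" by simp
  finally have "(\<Sum>e\<in>P. detour Z (p e) (q e)) \<le> real (card P) * (9 * (1 + 200 * k) * harm M)" .
  moreover have "\<forall>l\<in>Z. \<bar>snd l\<bar> \<le> 2"
  proof
    fix l assume "l \<in> Z"
    then have "l \<in> mesh D \<lceil>4 * L * real D\<rceil>" using Z(1) unfolding \<Omega>_def by blast
    then obtain i :: int where "- 2 * int D \<le> i" "i \<le> 2 * int D" "snd l = of_int i / real D"
      by (auto simp: mesh_def)
    then have "\<bar>real_of_int i\<bar> \<le> 2 * real D" "snd l = of_int i / real D" by linarith+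
    then show "\<bar>snd l\<bar> \<le> 2" using D(2) by (simp add: abs_divide pos_divide_le_eq)
  qed
  moreover have "finite Z" using Z(1) finite_mesh finite_subset unfolding \<Omega>_def by blast
  ultimately show ?thesis using Z(2) by blast
qed

section \<open>The cost of the parts\<close>

context square_frame
begin

lemma track_length_le:
  assumes "\<bar>snd l\<bar> \<le> 2" shows "dist (fst (track l)) (snd (track l)) \<le> 3 * L"
proof -
  have "height l 0 - height l L = - (snd l * L)" by (simp add: height_def)
  moreover have "\<bar>snd l * L\<bar> \<le> 2 * L" using assms L_pos by (simp add: abs_mult)
  ultimately have "\<bar>height l 0 - height l L\<bar>^2 \<le> (2 * L)^2" by (intro power_mono) auto
  then have "(height l 0 - height l L)^2 \<le> 4 * L^2" by (simp add: power_mult_distrib)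
  moreover have "(3 * L)^2 = 9 * L^2" "(0 - L)^2 = L^2" "0 \<le> L^2" by (simp_all add: power_mult_distrib)
  ultimately have "(0 - L)^2 + (height l 0 - height l L)^2 \<le> (3 * L)^2" by linarith
  then have "sqrt ((0 - L)^2 + (height l 0 - height l L)^2) \<le> 3 * L"
    using L_pos by (intro real_le_lsqrt) auto
  then show ?thesis by (simp add: track_def dist_pt)
qed

definition in_square :: "nat \<Rightarrow> (nat \<Rightarrow> point) \<Rightarrow> bool" where
  "in_square n x \<longleftrightarrow> (\<forall>i\<in>{1..n}. \<exists>a b. a \<in> {0..L} \<and> b \<in> {0..L} \<and> x i = pt a b)"

text \<open>Horizontal lines at unit distance, one vertical spine, and a vertical piece of length at most 1 from each
  point down to the line below it. It bounds the length of a Steiner tree linearly in \<open>n\<close>.\<close>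

lemma comb:
  assumes x: "in_square n x" and L: "L \<ge> 1"
  shows "\<exists>C. network_on n x C \<and> network_length C \<le> 2 * L^2 + L + real n"
proof -
  obtain a b where ab: "\<And>i. i \<in> {1..n} \<Longrightarrow> a i \<in> {0..L} \<and> b i \<in> {0..L} \<and> x i = pt (a i) (b i)"
    using x unfolding in_square_def by metis
  define rungs where "rungs = (\<lambda>j :: nat. (pt 0 (real j), pt L (real j))) ` {..nat \<lfloor>L\<rfloor>}"
  define spine where "spine = {(pt 0 0, pt 0 L)}"
  define drops where "drops = (\<lambda>i. (pt (a i) (b i), pt (a i) (of_int \<lfloor>b i\<rfloor>))) ` {1..n}"
  define C where "C = rungs \<union> (spine \<union> drops)"
  have fin: "finite rungs" "finite spine" "finite drops"
    by (auto simp: rungs_def spine_def drops_def)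
  have home: "\<exists>l. reaches C (x i) (pt 0 0) l" if i: "i \<in> {1..n}" for i
  proof -
    define f where "f = real_of_int \<lfloor>b i\<rfloor>"
    have f: "f = real (nat \<lfloor>b i\<rfloor>)" "0 \<le> f" "f \<le> L" "nat \<lfloor>b i\<rfloor> \<le> nat \<lfloor>L\<rfloor>"
      using ab[OF i] unfolding f_def by (auto simp: floor_mono nat_mono of_nat_nat) linarith
    have "(x i, pt (a i) f) \<in> C" using i ab[OF i] by (auto simp: C_def drops_def f_def)
    then have 1: "reaches C (x i) (pt (a i) f) (dist (x i) (pt (a i) f))"
      by (rule reaches_segment) auto
    have tr: "track (f, 0) \<in> C" unfolding C_def rungs_def track_def using f by (auto simp: height_def)
    have "pt (a i) f \<in> closed_segment (fst (track (f, 0))) (snd (track (f, 0)))"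
      using pt_on_track[of "a i" "(f, 0)"] ab[OF i] by (simp add: height_def)
    moreover have "pt 0 f \<in> closed_segment (fst (track (f, 0))) (snd (track (f, 0)))"
      using pt_on_track[of 0 "(f, 0)"] L by (simp add: height_def)
    ultimately have 2: "reaches C (pt (a i) f) (pt 0 f) (dist (pt (a i) f) (pt 0 f))"
      using tr reaches_segment[of "fst (track (f, 0))" "snd (track (f, 0))"] by simp
    have "pt 0 f \<in> closed_segment (pt 0 0) (pt 0 L)" using pt_on_riser[of 0 f L 0] f by simp
    then have 3: "reaches C (pt 0 f) (pt 0 0) (dist (pt 0 f) (pt 0 0))"
      by (intro reaches_segment[of "pt 0 0" "pt 0 L"]) (auto simp: C_def spine_def)
    show ?thesis using reaches_trans[OF 1 reaches_trans[OF 2 3]] by blast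
  qed
  have "network_on n x C"
    unfolding network_on_def
  proof (intro conjI ballI impI)
    show "finite C" using fin by (simp add: C_def)
    fix i j assume "i \<in> {1..n}" "j \<in> {1..n}"
    then show "\<exists>ps. route C (x i) (x j) ps"
      using home[of i] home[of j] reaches_trans reaches_sym reaches_ex_route by blast
  qed
  moreover have "network_length C \<le> 2 * L^2 + L + real n"
  proof -
    have "network_length rungs \<le> real (card {..nat \<lfloor>L\<rfloor>}) * L"
      unfolding rungs_def using L by (intro network_length_image_le) (auto simp: dist_pt)
    also have "\<dots> \<le> (2 * L) * L" using L by (intro mult_right_mono) (auto simp: of_nat_nat, linarith)
    finally have "network_length rungs \<le> 2 * L^2" by (simp add: power2_eq_square)
    moreover have "network_length spine = L" using L by (simp add: spine_def network_length_def dist_pt)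
    moreover have "dist (pt (a i) (b i)) (pt (a i) (of_int \<lfloor>b i\<rfloor>)) \<le> 1" for i
      by (simp add: dist_pt) linarith
    then have "network_length drops \<le> real (card {1..n}) * 1"
      unfolding drops_def by (intro network_length_image_le) auto
    moreover have "network_length C \<le> network_length rungs + (network_length spine + network_length drops)"
      unfolding C_def using fin network_length_Un_le[of rungs "spine \<union> drops"]
        network_length_Un_le[of spine drops] by auto
    ultimately show ?thesis by simp
  qed
  ultimately show ?thesis by blast
qed

end

text \<open>Relative to a pair of slope at most 1 in absolute value, slope 2 is ascending and slope -2 descending, so these
  lines guarantee that the envelope is never empty and is close to both end points.\<close>

definition grid_lines :: "real \<Rightarrow> real \<Rightarrow> (real \<times> real) set" where
  "grid_lines L k = (\<lambda>(j :: int, s). (k * of_int j, s)) ` ({- \<lceil>3 * L / k\<rceil>..\<lceil>3 * L / k\<rceil>} \<times> {2, - 2})"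

lemma grid_line_above:
  assumes k: "k > 0" and xy: "0 \<le> x" "x \<le> L" "0 \<le> y" "y \<le> L" and s: "s = 2 \<or> s = - 2"
  shows "\<exists>l\<in>grid_lines L k. snd l = s \<and> y \<le> height l x \<and> height l x \<le> y + k"
proof -
  define j where "j = \<lceil>(y - s * x) / k\<rceil>"
  have "\<bar>y - s * x\<bar> \<le> 3 * L" using xy s by auto
  then have "(y - s * x) / k \<le> 3 * L / k" "- (3 * L / k) \<le> (y - s * x) / k"
    using k divide_right_mono[of "y - s * x" "3 * L" k] divide_right_mono[of "- (3 * L)" "y - s * x" k]
    by auto
  then have "j \<in> {- \<lceil>3 * L / k\<rceil>..\<lceil>3 * L / k\<rceil>}" unfolding j_def by (auto simp: ceiling_mono) linarith
  then have "(k * of_int j, s) \<in> grid_lines L k" using s by (auto simp: grid_lines_def)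
  moreover have "(y - s * x) / k \<le> of_int j" "of_int j \<le> (y - s * x) / k + 1"
    unfolding j_def by linarith+
  then have "y \<le> k * of_int j + s * x" "k * of_int j + s * x \<le> y + k"
    using k by (auto simp: field_simps)
  ultimately show ?thesis by (intro bexI[of _ "(k * of_int j, s)"]) (auto simp: height_def)
qed

lemma grid_lines_props:
  assumes "k > 0" "L \<ge> 0"
  shows "finite (grid_lines L k)" "real (card (grid_lines L k)) \<le> 12 * L / k + 6"
    "\<And>l. l \<in> grid_lines L k \<Longrightarrow> \<bar>snd l\<bar> \<le> 2"
proof -
  define B where "B = \<lceil>3 * L / k\<rceil>"
  have "0 \<le> 3 * L / k" using assms by simp
  then have B: "0 \<le> B" "of_int B \<le> 3 * L / k + 1" unfolding B_def by linarith+
  show "finite (grid_lines L k)" "\<And>l. l \<in> grid_lines L k \<Longrightarrow> \<bar>snd l\<bar> \<le> 2"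
    by (auto simp: grid_lines_def)
  have "card (grid_lines L k) \<le> card ({- B..B} \<times> {2, - 2 :: real})"
    unfolding grid_lines_def B_def by (intro card_image_le) auto
  also have "\<dots> = nat (2 * B + 1) * 2" by (simp add: card_cartesian_product)
  finally have "real (card (grid_lines L k)) \<le> real (nat (2 * B + 1) * 2)"
    by (simp only: of_nat_le_iff)
  then have "real (card (grid_lines L k)) \<le> (2 * of_int B + 1) * 2" using B(1) by (simp add: of_nat_nat)
  then show "real (card (grid_lines L k)) \<le> 12 * L / k + 6"
  proof -
    define t where "t = L / k"
    have "12 * L / k = 12 * t" "3 * L / k = 3 * t" by (simp_all add: t_def)
    then show ?thesis using B(2) \<open>real (card (grid_lines L k)) \<le> (2 * of_int B + 1) * 2\<close> by simp
  qed
qed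

definition flip :: "real \<times> real \<Rightarrow> real \<times> real" where
  "flip p = (snd p, fst p)"

text \<open>Lines of slope at most 2 serve only pairs whose direction is within 45 degrees of the horizontal. The other
  pairs are reflected in the diagonal of the square, and every line is built together with its mirror image.\<close>

definition flat :: "real \<times> real \<Rightarrow> real \<times> real \<Rightarrow> bool" where
  "flat p q \<longleftrightarrow> \<bar>snd q - snd p\<bar> \<le> \<bar>fst q - fst p\<bar>"

definition ordered :: "real \<times> real \<Rightarrow> real \<times> real \<Rightarrow> (real \<times> real) \<times> (real \<times> real)" where
  "ordered p q = (if fst p < fst q then (p, q) else (q, p))"

definition oriented :: "real \<times> real \<Rightarrow> real \<times> real \<Rightarrow> (real \<times> real) \<times> (real \<times> real)" where
  "oriented p q = (if flat p q then ordered p q else ordered (flip p) (flip q))"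

lemma oriented:
  assumes "p \<noteq> q"
  shows "fst (fst (oriented p q)) < fst (snd (oriented p q))"
    "\<bar>snd (snd (oriented p q)) - snd (fst (oriented p q))\<bar>
      \<le> fst (snd (oriented p q)) - fst (fst (oriented p q))"
  using assms unfolding oriented_def ordered_def flip_def flat_def
  by (auto simp: prod_eq_iff split: if_splits)

lemma oriented_in:
  assumes "fst p \<in> {0..L} \<and> snd p \<in> {0..L}" "fst q \<in> {0..L} \<and> snd q \<in> {0..L}"
  shows "fst (fst (oriented p q)) \<in> {0..L}" "snd (fst (oriented p q)) \<in> {0..L}"
    "fst (snd (oriented p q)) \<in> {0..L}" "snd (snd (oriented p q)) \<in> {0..L}"
  using assms unfolding oriented_def ordered_def flip_def by auto

context square_frame
begin

lemma reaches_ordered: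
  assumes pq: "fst p \<noteq> fst q" "flat p q"
    and inside: "fst p \<in> {0..L}" "snd p \<in> {0..L}" "fst q \<in> {0..L}" "snd q \<in> {0..L}"
    and F: "finite F" "grid_lines L k \<subseteq> F" "\<And>l. l \<in> F \<Longrightarrow> \<bar>snd l\<bar> \<le> 2" "track ` F \<subseteq> G"
    and k: "k > 0"
    and risers: "(pt (fst p) (snd p), pt (fst p) (snd p + k)) \<in> G"
      "(pt (fst q) (snd q), pt (fst q) (snd q + k)) \<in> G"
  shows "reaches G (pt (fst p) (snd p)) (pt (fst q) (snd q))
    (dist (pt (fst p) (snd p)) (pt (fst q) (snd q)) + 3 * k + 18
      + detour F (fst (ordered p q)) (snd (ordered p q)))"
proof -
  have *: "reaches G (pt (fst p) (snd p)) (pt (fst q) (snd q))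
    (dist (pt (fst p) (snd p)) (pt (fst q) (snd q)) + 3 * k + 18 + detour F p q)"
    if asm: "fst p < fst q" "flat p q" "fst p \<in> {0..L}" "snd p \<in> {0..L}" "fst q \<in> {0..L}" "snd q \<in> {0..L}"
      "(pt (fst p) (snd p), pt (fst p) (snd p + k)) \<in> G"
      "(pt (fst q) (snd q), pt (fst q) (snd q + k)) \<in> G" for p q
  proof -
    obtain l1 where l1: "l1 \<in> grid_lines L k" "snd l1 = 2" "snd p \<le> height l1 (fst p)"
      "height l1 (fst p) \<le> snd p + k" using grid_line_above[OF k, of "fst p" L "snd p" 2] asm by auto
    obtain l2 where l2: "l2 \<in> grid_lines L k" "snd l2 = - 2" "snd q \<le> height l2 (fst q)"
      "height l2 (fst q) \<le> snd q + k" using grid_line_above[OF k, of "fst q" L "snd q" "- 2"] asm by auto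
    show ?thesis
      by (rule reaches_pair[OF _ _ _ _ F(1,4,3) _ l1(2-4) _ l2(2-4)])
        (use asm l1 l2 F(2) in \<open>auto simp: flat_def\<close>)
  qed
  show ?thesis
  proof (cases "fst p < fst q")
    case True
    then show ?thesis using * assms unfolding ordered_def by simp
  next
    case False
    then have "fst q < fst p" "flat q p" using pq by (auto simp: flat_def abs_minus_commute)
    then show ?thesis using *[of q p] assms False reaches_sym unfolding ordered_def
      by (simp add: dist_commute)
  qed
qed

end

section \<open>The augmented network\<close>

text \<open>The parameter \<open>k\<close> trades length against excess. The tree is augmented by the grid of spacing \<open>k\<close> and by
  \<open>L / k\<close> chosen lines, all of length \<open>O(L)\<close>, for a cost of \<open>O(n / k)\<close>. Access roads of length \<open>k\<close> are affordable
  only at \<open>O(n / k\<^sup>2)\<close> points; the net of radius \<open>k\<^sup>2\<close> in the tree has that size, and all other points use the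
  tree to get to a net point, for an excess of \<open>O(k\<^sup>2)\<close>.\<close>

lemma short_network:
  fixes x :: "nat \<Rightarrow> point" and k :: real
  assumes Q: "is_square Q (sqrt (real n))" "\<And>i. i \<in> {1..n} \<Longrightarrow> x i \<in> Q"
    and ST: "steiner_tree n x T" and k: "1 \<le> k" "k^2 \<le> real n" and n: "n \<ge> 3"
  shows "\<exists>G. network_on n x G \<and> network_length T \<le> network_length G \<and>
    network_length G \<le> network_length T + 150 * real n / k \<and>
    0 \<le> excess n x G \<and> excess n x G \<le> 4000 * k^2 * ln (real n)"
proof -
  define L where "L = sqrt (real n)"
  have L2: "L^2 = real n" by (simp add: L_def)
  have "sqrt (k^2) \<le> L" unfolding L_def using k(2) by (intro real_sqrt_le_mono)
  then have kL: "k \<le> L" using k(1) by simp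
  then have L: "1 \<le> L" "0 < L" using k(1) by auto
  have "L * 1 \<le> L * L" using L by (intro mult_left_mono) auto
  then have Ln: "L \<le> real n" using L2 by (simp add: power2_eq_square)
  obtain c u v where cuv: "norm u = 1" "norm v = 1" "u \<bullet> v = 0"
    "Q = {c + s *\<^sub>R u + t *\<^sub>R v | s t. s \<in> {0..L} \<and> t \<in> {0..L}}"
    using Q(1) unfolding is_square_def L_def[symmetric] by blast
  interpret A: square_frame c u v L by unfold_locales (use cuv L in auto)
  interpret B: square_frame c v u L by unfold_locales (use cuv L in \<open>auto simp: inner_commute\<close>)
  have BA: "B.pt b a = A.pt a b" for a b by (simp add: A.pt_def B.pt_def)
  have cov: "A.in_square n x"
    unfolding A.in_square_def
  proof
    fix i assume "i \<in> {1..n}"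
    then have "x i \<in> Q" by (rule Q(2))
    then show "\<exists>a b. a \<in> {0..L} \<and> b \<in> {0..L} \<and> x i = A.pt a b"
      unfolding cuv(4) A.pt_def by blast
  qed
  have Tnet: "network_on n x T" and finT: "finite T"
    using ST by (auto simp: steiner_tree_def network_on_def)
  obtain C where C: "network_on n x C" "network_length C \<le> 2 * L^2 + L + real n"
    using A.comb[OF cov L(1)] by blast
  have lenT: "network_length T \<le> 4 * real n"
    using ST C Ln unfolding steiner_tree_def L2 by fastforce
  define F where "F = x ` {1..n}"
  have "finite F" by (simp add: F_def)
  have "\<exists>ps. route T (x 1) p ps" if "p \<in> F" for p
  proof -
    obtain i where i: "i \<in> {1..n}" "p = x i" using \<open>p \<in> F\<close> by (auto simp: F_def)
    show ?thesis
    proof (cases "i = 1")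
      case True
      then show ?thesis using i reaches_refl[of 0 T "x 1"] reaches_ex_route by auto
    next
      case False
      then show ?thesis using Tnet i n unfolding network_on_def by auto
    qed
  qed
  then obtain r where r: "r ` F \<subseteq> F" "real (card (r ` F)) \<le> 2 * network_length T / k^2 + 1"
    "\<And>p. p \<in> F \<Longrightarrow> reaches T p (r p) (k^2)"
    using sparse_net[OF finT \<open>finite F\<close>, of "x 1" "k^2"] k(1) by auto
  have "\<forall>p\<in>F. \<exists>z. fst z \<in> {0..L} \<and> snd z \<in> {0..L} \<and> p = A.pt (fst z) (snd z)"
    using cov unfolding A.in_square_def F_def by auto
  then obtain co where co: "\<And>p. p \<in> F \<Longrightarrow> fst (co p) \<in> {0..L} \<and> snd (co p) \<in> {0..L} \<and>
      p = A.pt (fst (co p)) (snd (co p))" by metis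
  define pairs where "pairs = {(i, j). i \<in> {1..n} \<and> j \<in> {1..n} \<and> i \<noteq> j}"
  have "pairs \<subseteq> {1..n} \<times> {1..n}" by (auto simp: pairs_def)
  then have finpairs: "finite pairs" using finite_subset by blast
  have "(1, 2) \<in> pairs" using n by (auto simp: pairs_def)
  then have cardpairs: "card pairs > 0" using finpairs card_gt_0_iff by blast
  define ori where "ori e = oriented (co (r (x (fst e)))) (co (r (x (snd e))))" for e :: "nat \<times> nat"
  define P where "P = {e \<in> pairs. co (r (x (fst e))) \<noteq> co (r (x (snd e)))}"
  have finP: "finite P" using finpairs by (simp add: P_def)
  have rF: "r (x i) \<in> F" if "i \<in> {1..n}" for i using r(1) that by (auto simp: F_def)
  have Pin: "r (x (fst e)) \<in> F" "r (x (snd e)) \<in> F" if "e \<in> P" for e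
    using that rF by (auto simp: P_def pairs_def)
  have inL: "fst (co z) \<in> {0..L} \<and> snd (co z) \<in> {0..L}" if "z \<in> F" for z using co[OF that] by blast
  define N where "N = nat \<lceil>L / k\<rceil>"
  have N: "L / k \<le> real N" "real N \<le> L / k + 1" using L k unfolding N_def by (auto simp: of_nat_nat)
  have "\<exists>Z. finite Z \<and> card Z \<le> N \<and> (\<forall>l\<in>Z. \<bar>snd l\<bar> \<le> 2) \<and>
    (\<Sum>e\<in>P. detour Z (fst (ori e)) (snd (ori e))) \<le> real (card P) * (9 * (1 + 200 * k) * harm n)"
  proof (rule few_lines_short_detours[OF finP L(1) Ln _ N(1)])
    show "0 < k" using k by simp
    fix e assume e: "e \<in> P"
    note in2 = oriented_in[OF inL[OF Pin(1)[OF e]] inL[OF Pin(2)[OF e]]]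
    show "0 \<le> fst (fst (ori e)) \<and> fst (fst (ori e)) \<le> L \<and> 0 \<le> snd (fst (ori e)) \<and> snd (fst (ori e)) \<le> L"
      "0 \<le> fst (snd (ori e)) \<and> fst (snd (ori e)) \<le> L \<and> 0 \<le> snd (snd (ori e)) \<and> snd (snd (ori e)) \<le> L"
      using in2 unfolding ori_def by auto
    show "fst (fst (ori e)) < fst (snd (ori e)) \<and>
        \<bar>snd (snd (ori e)) - snd (fst (ori e))\<bar> \<le> fst (snd (ori e)) - fst (fst (ori e))"
      using oriented e unfolding ori_def P_def by blast
  qed
  then obtain Z where Z: "finite Z" "card Z \<le> N" "\<And>l. l \<in> Z \<Longrightarrow> \<bar>snd l\<bar> \<le> 2"
    "(\<Sum>e\<in>P. detour Z (fst (ori e)) (snd (ori e))) \<le> real (card P) * (9 * (1 + 200 * k) * harm n)"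
    by blast
  define F' where "F' = Z \<union> grid_lines L k"
  have grid: "finite (grid_lines L k)" "real (card (grid_lines L k)) \<le> 12 * L / k + 6"
    "\<And>l. l \<in> grid_lines L k \<Longrightarrow> \<bar>snd l\<bar> \<le> 2" using grid_lines_props[of k L] k L by auto
  have finF': "finite F'" using Z grid by (simp add: F'_def)
  have slope: "\<bar>snd l\<bar> \<le> 2" if "l \<in> F'" for l using that Z(3)[of l] grid(3)[of l] unfolding F'_def by blast
  have "card F' \<le> card Z + card (grid_lines L k)" unfolding F'_def by (rule card_Un_le)
  then have "real (card F') \<le> real N + real (card (grid_lines L k))" using Z(2) by linarith
  moreover have "13 * L / k = L / k + 12 * L / k" by (simp add: add_divide_distrib[symmetric])
  ultimately have cardF': "real (card F') \<le> 13 * L / k + 7" using N(2) grid(2) by simp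
  \<comment> \<open>Each net point gets two access roads, one for each of the two families of lines.\<close>
  define RA where "RA = (\<lambda>z. (A.pt (fst (co z)) (snd (co z)), A.pt (fst (co z)) (snd (co z) + k))) ` r ` F"
  define RB where "RB = (\<lambda>z. (A.pt (fst (co z)) (snd (co z)), A.pt (fst (co z) + k) (snd (co z)))) ` r ` F"
  define G where "G = T \<union> ((A.track ` F' \<union> B.track ` F') \<union> (RA \<union> RB))"
  have fins: "finite (A.track ` F')" "finite (B.track ` F')" "finite RA" "finite RB"
    using finF' \<open>finite F\<close> by (auto simp: RA_def RB_def)
  then have finG: "finite G" using finT by (simp add: G_def)
  have TG: "T \<subseteq> G" by (simp add: G_def)
  have net: "network_on n x G"
    unfolding network_on_def
  proof (intro conjI ballI impI)
    fix i j assume "i \<in> {1..n}" "j \<in> {1..n}" "i \<noteq> j"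
    then obtain ps where "route T (x i) (x j) ps" using Tnet unfolding network_on_def by blast
    then have "reaches T (x i) (x j) (polyline_length ps)" unfolding reaches_def by blast
    then show "\<exists>ps. route G (x i) (x j) ps" using reaches_mono[OF _ TG order_refl] reaches_ex_route by blast
  qed (fact finG)
  have lenG: "network_length G \<le> network_length T + 150 * real n / k"
  proof -
    define t where "t = real n / k"
    have t: "0 \<le> t" using k by (simp add: t_def)
    have lines: "real (card F') * (3 * L) \<le> 60 * t"
    proof -
      have "real (card F') * (3 * L) \<le> (13 * L / k + 7) * (3 * L)"
        using cardF' L by (intro mult_right_mono) auto
      also have "\<dots> = (39 * L^2 + 21 * (L * k)) / k" using k by (simp add: field_simps power2_eq_square)
      also have "\<dots> \<le> (39 * L^2 + 21 * (L * L)) / k"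
        using k kL L by (intro divide_right_mono add_left_mono mult_left_mono) auto
      also have "\<dots> = 60 * t" using L2 by (simp add: power2_eq_square t_def)
      finally show ?thesis .
    qed
    have "network_length (A.track ` F') \<le> real (card F') * (3 * L)"
      using finF' slope A.track_length_le by (intro network_length_image_le) blast+
    moreover have "network_length (B.track ` F') \<le> real (card F') * (3 * L)"
      using finF' slope B.track_length_le by (intro network_length_image_le) blast+
    moreover have "network_length RA \<le> real (card (r ` F)) * k"
      unfolding RA_def using \<open>finite F\<close> k by (intro network_length_image_le) (auto simp: A.dist_pt)
    moreover have "network_length RB \<le> real (card (r ` F)) * k"
      unfolding RB_def using \<open>finite F\<close> k by (intro network_length_image_le) (auto simp: A.dist_pt)
    moreover have "real (card (r ` F)) * k \<le> 9 * t"
    proof -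
      have "2 * network_length T / k^2 \<le> 2 * (4 * real n) / k^2"
        using lenT by (intro divide_right_mono) auto
      then have "real (card (r ` F)) \<le> 2 * (4 * real n) / k^2 + 1" using r(2) by linarith
      then have "real (card (r ` F)) * k \<le> (2 * (4 * real n) / k^2 + 1) * k"
        using k by (intro mult_right_mono) auto
      also have "\<dots> = (8 * real n + k^2) / k" using k by (simp add: field_simps power2_eq_square)
      also have "\<dots> \<le> (9 * real n) / k" using k by (intro divide_right_mono) auto
      finally show ?thesis by (simp add: t_def)
    qed
    moreover have "network_length G \<le> network_length T + ((network_length (A.track ` F')
        + network_length (B.track ` F')) + (network_length RA + network_length RB))"
    proof -
      have "network_length G \<le> network_length T + network_length ((A.track ` F' \<union> B.track ` F') \<union> (RA \<union> RB))"
        unfolding G_def using fins finT by (intro network_length_Un_le) auto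
      also have "network_length ((A.track ` F' \<union> B.track ` F') \<union> (RA \<union> RB))
          \<le> network_length (A.track ` F' \<union> B.track ` F') + network_length (RA \<union> RB)"
        using fins by (intro network_length_Un_le) auto
      also have "network_length (A.track ` F' \<union> B.track ` F')
          \<le> network_length (A.track ` F') + network_length (B.track ` F')"
        using fins by (intro network_length_Un_le) auto
      also have "network_length (RA \<union> RB) \<le> network_length RA + network_length RB"
        using fins by (intro network_length_Un_le) auto
      finally show ?thesis by simp
    qed
    moreover have "150 * real n / k = 150 * t" by (simp add: t_def)
    ultimately show ?thesis using lines t by linarith
  qed
  have gridF': "grid_lines L k \<subseteq> F'" and trackA: "A.track ` F' \<subseteq> G" and trackB: "B.track ` F' \<subseteq> G"
    unfolding F'_def G_def by blast+
  have jump: "reaches G y z (dist y z + 3 * k + 18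
      + detour F' (fst (oriented (co y) (co z))) (snd (oriented (co y) (co z))))"
    if yz: "y \<in> r ` F" "z \<in> r ` F" "co y \<noteq> co z" for y z
  proof -
    have yz': "y \<in> F" "z \<in> F" using yz r(1) by auto
    have Y: "fst (co y) \<in> {0..L}" "snd (co y) \<in> {0..L}" "A.pt (fst (co y)) (snd (co y)) = y"
      and Z': "fst (co z) \<in> {0..L}" "snd (co z) \<in> {0..L}" "A.pt (fst (co z)) (snd (co z)) = z"
      using co[OF yz'(1)] co[OF yz'(2)] by auto
    have RA: "(A.pt (fst (co t)) (snd (co t)), A.pt (fst (co t)) (snd (co t) + k)) \<in> G"
      and RB: "(A.pt (fst (co t)) (snd (co t)), A.pt (fst (co t) + k) (snd (co t))) \<in> G"
      if "t \<in> r ` F" for t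
      using that unfolding G_def RA_def RB_def by blast+
    show ?thesis
    proof (cases "flat (co y) (co z)")
      case True
      have "fst (co y) \<noteq> fst (co z)" using yz(3) True by (auto simp: flat_def prod_eq_iff)
      then have "reaches G (A.pt (fst (co y)) (snd (co y))) (A.pt (fst (co z)) (snd (co z)))
        (dist (A.pt (fst (co y)) (snd (co y))) (A.pt (fst (co z)) (snd (co z))) + 3 * k + 18
        + detour F' (fst (ordered (co y) (co z))) (snd (ordered (co y) (co z))))"
        using k by (intro A.reaches_ordered[OF _ True Y(1,2) Z'(1,2) finF' gridF' slope trackA _ RA RA] yz) auto
      then show ?thesis using True unfolding Y(3) Z'(3) by (simp add: oriented_def)
    next
      case False
      let ?p = "flip (co y)" and ?q = "flip (co z)"
      have flipped: "fst ?p = snd (co y)" "snd ?p = fst (co y)" "fst ?q = snd (co z)" "snd ?q = fst (co z)"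
        by (simp_all add: flip_def)
      have "fst ?p \<noteq> fst ?q" "flat ?p ?q" using False by (auto simp: flat_def flip_def)
      then have "reaches G (B.pt (fst ?p) (snd ?p)) (B.pt (fst ?q) (snd ?q))
        (dist (B.pt (fst ?p) (snd ?p)) (B.pt (fst ?q) (snd ?q)) + 3 * k + 18
        + detour F' (fst (ordered ?p ?q)) (snd (ordered ?p ?q)))"
        using k Y(1,2) Z'(1,2) RB[OF yz(1)] RB[OF yz(2)]
        by (intro B.reaches_ordered[OF _ _ _ _ _ _ finF' gridF' slope trackB]) (simp_all add: flipped BA)
      then show ?thesis using False unfolding flipped BA Y(3) Z'(3) by (simp add: oriented_def)
    qed
  qed
  define det where "det e = (if e \<in> P then detour F' (fst (ori e)) (snd (ori e)) else 0)" for e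
  have bound: "route_length G (x (fst e)) (x (snd e)) - dist (x (fst e)) (x (snd e))
      \<le> 4 * k^2 + 3 * k + 18 + det e" if e: "e \<in> pairs" for e
  proof -
    define y z where "y = x (fst e)" and "z = x (snd e)"
    have yz: "y \<in> F" "z \<in> F" using e by (auto simp: y_def z_def F_def pairs_def)
    have 1: "reaches G y (r y) (k^2)" and 3: "reaches G (r z) z (k^2)"
      using r(3)[OF yz(1)] r(3)[OF yz(2)] reaches_mono[OF _ TG order_refl] reaches_sym by blast+
    have 2: "reaches G (r y) (r z) (dist (r y) (r z) + 3 * k + 18 + det e)"
    proof (cases "e \<in> P")
      case True
      then show ?thesis using jump[of "r y" "r z"] yz unfolding det_def ori_def P_def y_def z_def by auto
    next
      case False
      then have "co (r y) = co (r z)" using e by (auto simp: P_def y_def z_def)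
      moreover have "r y \<in> F" "r z \<in> F" using yz r(1) by auto
      ultimately have "r y = r z" using co by metis
      then show ?thesis using k False by (auto simp: det_def intro: reaches_refl)
    qed
    have "route_length G y z \<le> k^2 + ((dist (r y) (r z) + 3 * k + 18 + det e) + k^2)"
      by (intro route_length_le reaches_trans[OF 1] reaches_trans[OF 2 3])
    moreover have "dist (r y) (r z) \<le> k^2 + dist y z + k^2"
      using reaches_dist[OF 1] reaches_dist[OF 3] dist_triangle[of "r y" "r z" y] dist_triangle[of y "r z" z]
      by (simp add: dist_commute)
    ultimately show ?thesis unfolding y_def z_def by linarith
  qed
  have dets: "(\<Sum>e\<in>pairs. det e) \<le> real (card pairs) * (9 * (1 + 200 * k) * harm n)"
  proof -
    have "(\<Sum>e\<in>pairs. det e) = (\<Sum>e\<in>P. detour F' (fst (ori e)) (snd (ori e)))"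
      using finpairs unfolding det_def by (intro sum.mono_neutral_cong_right) (auto simp: P_def)
    also have "\<dots> \<le> (\<Sum>e\<in>P. detour Z (fst (ori e)) (snd (ori e)))"
      by (intro sum_mono detour_antimono) (auto simp: F'_def)
    also note Z(4)
    also have "real (card P) * (9 * (1 + 200 * k) * harm n) \<le> real (card pairs) * (9 * (1 + 200 * k) * harm n)"
    proof (rule mult_right_mono)
      show "real (card P) \<le> real (card pairs)"
        using finpairs by (auto simp: P_def intro!: card_mono)
      show "0 \<le> 9 * (1 + 200 * k) * harm n"
        using k by (intro mult_nonneg_nonneg harm_nonneg) auto
    qed
    finally show ?thesis .
  qed
  have exc: "excess n x G = (\<Sum>e\<in>pairs. route_length G (x (fst e)) (x (snd e)) - dist (x (fst e)) (x (snd e))) / real (card pairs)"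
    unfolding excess_def pairs_def[symmetric] by (simp add: case_prod_beta)
  have "excess n x G \<le> (4 * k^2 + 3 * k + 18) + 9 * (1 + 200 * k) * harm n"
  proof -
    have "(\<Sum>e\<in>pairs. route_length G (x (fst e)) (x (snd e)) - dist (x (fst e)) (x (snd e)))
      \<le> (\<Sum>e\<in>pairs. 4 * k^2 + 3 * k + 18 + det e)" by (intro sum_mono bound)
    also have "\<dots> = real (card pairs) * (4 * k^2 + 3 * k + 18) + (\<Sum>e\<in>pairs. det e)"
      by (simp add: sum.distrib)
    also have "\<dots> \<le> real (card pairs) * ((4 * k^2 + 3 * k + 18) + 9 * (1 + 200 * k) * harm n)"
      using dets by (simp add: distrib_left)
    finally show ?thesis unfolding exc using cardpairs by (simp add: field_simps)
  qed
  also have "\<dots> \<le> 4000 * k^2 * ln (real n)"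
  proof -
    have "exp 1 \<le> real n" using exp_le n by linarith
    \<comment> \<open>All constants are absorbed into the logarithm.\<close>
    then have ln1: "1 \<le> ln (real n)" using n by (simp add: ln_ge_iff)
    have "harm n - ln (of_nat n) \<le> harm 1 - ln (of_nat 1 :: real)"
      using n by (intro euler_mascheroni_sequence_decreasing) auto
    then have harm: "harm n \<le> 2 * ln (real n)" using ln1 by (simp add: harm_expand)
    have "9 * (1 + 200 * k) * harm n \<le> 9 * (1 + 200 * k) * (2 * ln (real n))"
      using harm k by (intro mult_left_mono) auto
    moreover have "(4 * k^2 + 3 * k + 18) * 1 \<le> (4 * k^2 + 3 * k + 18) * ln (real n)"
      using ln1 k by (intro mult_left_mono) auto
    moreover have "(4 * k^2 + 3 * k + 18 + 9 * (1 + 200 * k) * 2) * ln (real n) \<le> 4000 * k^2 * ln (real n)"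
    proof (rule mult_right_mono)
      have "k \<le> k^2" using k(1) by (intro self_le_power) auto
      moreover have "4 * k^2 + 3 * k + 18 + 9 * (1 + 200 * k) * 2 = 4 * k^2 + 3603 * k + 36"
        by (simp add: algebra_simps)
      ultimately show "4 * k^2 + 3 * k + 18 + 9 * (1 + 200 * k) * 2 \<le> 4000 * k^2"
        using k(1) by linarith
    qed (use ln1 in auto)
    ultimately show ?thesis by (simp add: algebra_simps)
  qed
  finally have "excess n x G \<le> 4000 * k^2 * ln (real n)" .
  moreover have "0 \<le> excess n x G"
  proof -
    have "0 \<le> route_length G (x (fst e)) (x (snd e)) - dist (x (fst e)) (x (snd e))" if "e \<in> pairs" for e
      using net that dist_le_route_length unfolding network_on_def pairs_def by fastforce
    then show ?thesis unfolding exc by (intro divide_nonneg_nonneg sum_nonneg) auto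
  qed
  moreover have "network_length T \<le> network_length G" using network_length_mono[OF finG TG] .
  ultimately show ?thesis using net lenG by blast
qed

theorem theorem1:
  fixes x :: "nat \<Rightarrow> nat \<Rightarrow> point"
    and Q :: "nat \<Rightarrow> point set"
    and ST :: "nat \<Rightarrow> network"
  assumes square: "\<And>n. is_square (Q n) (sqrt (real n))"
    and config: "\<And>n i. i \<in> {1..n} \<Longrightarrow> x n i \<in> Q n"
    and steiner: "\<And>n. steiner_tree n (x n) (ST n)"
  shows "(\<forall>w :: nat \<Rightarrow> real. filterlim w at_top sequentially \<longrightarrow>
            (\<exists>G :: nat \<Rightarrow> network. (\<forall>n. network_on n (x n) (G n)) \<and>
               (\<lambda>n. network_length (G n) - network_length (ST n)) \<in> o(\<lambda>n. real n) \<and>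
               (\<lambda>n. excess n (x n) (G n)) \<in> o(\<lambda>n. w n * ln (real n)))) \<and>
         (\<forall>\<epsilon>::real. \<epsilon> > 0 \<longrightarrow>
            (\<exists>G :: nat \<Rightarrow> network. (\<forall>n. network_on n (x n) (G n)) \<and>
               (\<forall>\<^sub>F n in sequentially.
                  network_length (G n) - network_length (ST n) \<le> \<epsilon> * real n) \<and>
               (\<lambda>n. excess n (x n) (G n)) \<in> O(\<lambda>n. ln (real n))))"
proof -
  have nets: "\<exists>G. \<forall>n. network_on n (x n) (G n) \<and>
      (1 \<le> k n \<and> k n ^ 2 \<le> real n \<and> n \<ge> 3 \<longrightarrow>
        \<bar>network_length (G n) - network_length (ST n)\<bar> \<le> 150 * real n / k n \<and>
        \<bar>excess n (x n) (G n)\<bar> \<le> 4000 * k n ^ 2 * ln (real n))" for k :: "nat \<Rightarrow> real"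
  proof (rule choice, rule allI)
    fix n
    \<comment> \<open>Where the bounds are not claimed, the tree itself serves as the network.\<close>
    show "\<exists>G. network_on n (x n) G \<and> (1 \<le> k n \<and> k n ^ 2 \<le> real n \<and> n \<ge> 3 \<longrightarrow>
        \<bar>network_length G - network_length (ST n)\<bar> \<le> 150 * real n / k n \<and>
        \<bar>excess n (x n) G\<bar> \<le> 4000 * k n ^ 2 * ln (real n))"
    proof (cases "1 \<le> k n \<and> k n ^ 2 \<le> real n \<and> n \<ge> 3")
      case True
      then obtain G where "network_on n (x n) G" "network_length (ST n) \<le> network_length G"
        "network_length G \<le> network_length (ST n) + 150 * real n / k n"
        "0 \<le> excess n (x n) G" "excess n (x n) G \<le> 4000 * k n ^ 2 * ln (real n)"
        using short_network[OF square config steiner] by blast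
      then show ?thesis by (intro exI[of _ G]) auto
    next
      case False
      then show ?thesis using steiner[of n] unfolding steiner_tree_def by blast
    qed
  qed
  have large: "\<forall>\<^sub>F n in sequentially. b \<le> real n" for b :: real
    using filterlim_real_sequentially by (simp add: filterlim_at_top)
  show ?thesis
  proof (intro conjI allI impI)
    fix w :: "nat \<Rightarrow> real" assume w: "filterlim w at_top sequentially"
    \<comment> \<open>The cube root leaves a spare factor \<open>k n\<close> between the excess \<open>O(k n ^ 2 * ln n)\<close> and \<open>w n * ln n\<close>;
      the minimum with \<open>n\<close> keeps \<open>k n ^ 2 \<le> n\<close>.\<close>
    define k where "k n = root 3 (min (w n) (real n))" for n
    have k3: "k n ^ 3 = min (w n) (real n)" for n by (simp add: k_def odd_real_root_pow)
    have klarge: "\<forall>\<^sub>F n in sequentially. b \<le> k n" for b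
    proof -
      have "\<forall>\<^sub>F n in sequentially. b ^ 3 \<le> w n" using w by (simp add: filterlim_at_top)
      then show ?thesis using large[of "b ^ 3"]
      proof eventually_elim
        case (elim n)
        then have "root 3 (b ^ 3) \<le> k n" unfolding k_def by (intro real_root_le_mono) auto
        then show ?case by (simp add: odd_real_root_power_cancel)
      qed
    qed
    obtain G where net: "\<And>n. network_on n (x n) (G n)" and G: "\<And>n. 1 \<le> k n \<Longrightarrow> k n ^ 2 \<le> real n \<Longrightarrow> n \<ge> 3 \<Longrightarrow>
        \<bar>network_length (G n) - network_length (ST n)\<bar> \<le> 150 * real n / k n \<and>
        \<bar>excess n (x n) (G n)\<bar> \<le> 4000 * k n ^ 2 * ln (real n)" using nets[of k] by blast
    have ok: "\<forall>\<^sub>F n in sequentially. 1 \<le> k n \<and> k n ^ 2 \<le> real n \<and> n \<ge> 3"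
      using klarge[of 1] eventually_ge_at_top[of 3]
    proof eventually_elim
      case (elim n)
      have "k n ^ 2 \<le> k n ^ 3" using elim by (intro power_increasing) auto
      then show ?case using k3[of n] elim by auto
    qed
    show "\<exists>G. (\<forall>n. network_on n (x n) (G n)) \<and>
      (\<lambda>n. network_length (G n) - network_length (ST n)) \<in> o(\<lambda>n. real n) \<and>
      (\<lambda>n. excess n (x n) (G n)) \<in> o(\<lambda>n. w n * ln (real n))"
    proof (intro exI[of _ G] conjI allI)
      show "network_on n (x n) (G n)" for n by (rule net)
      show "(\<lambda>n. network_length (G n) - network_length (ST n)) \<in> o(\<lambda>n. real n)"
      proof (rule landau_o.smallI)
        fix c :: real assume "c > 0"
        show "\<forall>\<^sub>F n in sequentially. norm (network_length (G n) - network_length (ST n)) \<le> c * norm (real n)"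
          using ok klarge[of "150 / c"]
        proof eventually_elim
          case (elim n)
          have "150 / k n \<le> c" using elim \<open>c > 0\<close> by (simp add: field_simps)
          then have "150 / k n * real n \<le> c * real n" by (intro mult_right_mono) auto
          then show ?case using G[of n] elim by simp
        qed
      qed
      show "(\<lambda>n. excess n (x n) (G n)) \<in> o(\<lambda>n. w n * ln (real n))"
      proof (rule landau_o.smallI)
        fix c :: real assume "c > 0"
        show "\<forall>\<^sub>F n in sequentially. norm (excess n (x n) (G n)) \<le> c * norm (w n * ln (real n))"
          using ok klarge[of "4000 / c"]
        proof eventually_elim
          case (elim n)
          have ln0: "0 \<le> ln (real n)" using elim by simp
          have "4000 \<le> c * k n" using elim \<open>c > 0\<close> by (simp add: field_simps)
          then have "4000 * k n ^ 2 \<le> c * k n * k n ^ 2" by (intro mult_right_mono) auto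
          also have "\<dots> = c * k n ^ 3" by (simp add: power3_eq_cube power2_eq_square)
          also have "\<dots> \<le> c * w n" using k3[of n] \<open>c > 0\<close> by (intro mult_left_mono) auto
          finally have "4000 * k n ^ 2 * ln (real n) \<le> c * w n * ln (real n)"
            using ln0 by (intro mult_right_mono)
          also have "\<dots> \<le> c * norm (w n * ln (real n))"
            using \<open>c > 0\<close> by (simp add: mult.assoc)
          finally show ?case using G[of n] elim by simp
        qed
      qed
    qed
  next
    fix \<epsilon> :: real assume \<epsilon>: "\<epsilon> > 0"
    define k where "k = max 1 (150 / \<epsilon>)"
    have k: "1 \<le> k" "150 / k \<le> \<epsilon>" using \<epsilon> by (auto simp: k_def max_def field_simps)
    obtain G where net: "\<And>n. network_on n (x n) (G n)" and G: "\<And>n. 1 \<le> k \<Longrightarrow> k ^ 2 \<le> real n \<Longrightarrow> n \<ge> 3 \<Longrightarrow>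
        \<bar>network_length (G n) - network_length (ST n)\<bar> \<le> 150 * real n / k \<and>
        \<bar>excess n (x n) (G n)\<bar> \<le> 4000 * k ^ 2 * ln (real n)" using nets[of "\<lambda>_. k"] by blast
    have ok: "\<forall>\<^sub>F n in sequentially. k ^ 2 \<le> real n \<and> n \<ge> 3"
      using large[of "k ^ 2"] eventually_ge_at_top[of 3] by eventually_elim auto
    show "\<exists>G. (\<forall>n. network_on n (x n) (G n)) \<and>
      (\<forall>\<^sub>F n in sequentially. network_length (G n) - network_length (ST n) \<le> \<epsilon> * real n) \<and>
      (\<lambda>n. excess n (x n) (G n)) \<in> O(\<lambda>n. ln (real n))"
    proof (intro exI[of _ G] conjI allI)
      show "network_on n (x n) (G n)" for n by (rule net)
      show "\<forall>\<^sub>F n in sequentially. network_length (G n) - network_length (ST n) \<le> \<epsilon> * real n"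
        using ok
      proof eventually_elim
        case (elim n)
        have "150 / k * real n \<le> \<epsilon> * real n" using k by (intro mult_right_mono) auto
        then show ?case using G[OF k(1)] elim by fastforce
      qed
      show "(\<lambda>n. excess n (x n) (G n)) \<in> O(\<lambda>n. ln (real n))"
      proof (rule bigoI)
        show "\<forall>\<^sub>F n in sequentially. norm (excess n (x n) (G n)) \<le> 4000 * k ^ 2 * norm (ln (real n))"
          using ok
        proof eventually_elim
          case (elim n)
          then have "0 \<le> ln (real n)" by simp
          then show ?case using G[OF k(1), of n] elim by simp
        qed
      qed
    qed
  qed
qed

end
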